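(* Let $X$ be a standard Borel space, let $f:X\to X$ be a bounded-to-one Borel function, and let $\rho$ be the graph metric on $\Gamma_f$. Then $(X,\rho)$ has Borel asymptotic dimension at most $1$.
   Context: A function $f$ is bounded-to-one if there is $k\in\mathbb{N}$ with $|f^{-1}(y)|\le k$ for all $y$. $\Gamma_f$ is the Borel graph with vertex set $X$ in which $x,y\in X$ are adjacent if $f(x)=y$ or $f(y)=x$. The graph metric $\rho(x,y)$ is the least length of a path joining $x$ and $y$, and $+\infty$ if no such path exists. The Borel asymptotic dimension of $(X,\rho)$ is the least $d\in\mathbb{N}$ such that for every $r>0$ there is a Borel equivalence relation $E$ on $X$, with a finite uniform bound on the $\rho$-diameters of its classes, such that every closed $\rho$-ball of radius $r$ meets at most $d+1$ classes of $E$; it is $\infty$ if no such $d$ exists. *)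

theory Defs
  imports "HOL-Analysis.Analysis"
begin

(* Only the space and the sigma-algebra of M matter below; its measure is never used. *)
definition standard_borel :: "'a measure \<Rightarrow> bool" where
  "standard_borel M \<longleftrightarrow>
     (\<exists>T. topspace T = space M \<and> second_countable T \<and> completely_metrizable_space T \<and>
          sets M = sigma_sets (space M) {U. openin T U})"

definition bounded_to_one :: "'a set \<Rightarrow> ('a \<Rightarrow> 'b) \<Rightarrow> 'b set \<Rightarrow> bool" where
  "bounded_to_one X f Y \<longleftrightarrow>
     (\<exists>k::nat. \<forall>y\<in>Y. finite {x \<in> X. f x = y} \<and> card {x \<in> X. f x = y} \<le> k)"

(* A fixed point of f gives a loop, which no path (a list of distinct vertices) can use. *)
definition fun_graph_adj :: "'a set \<Rightarrow> ('a \<Rightarrow> 'a) \<Rightarrow> 'a \<Rightarrow> 'a \<Rightarrow> bool" where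
  "fun_graph_adj X f x y \<longleftrightarrow> x \<in> X \<and> y \<in> X \<and> (f x = y \<or> f y = x)"

definition graph_path :: "'a set \<Rightarrow> ('a \<Rightarrow> 'a \<Rightarrow> bool) \<Rightarrow> 'a \<Rightarrow> 'a list \<Rightarrow> 'a \<Rightarrow> bool" where
  "graph_path V adj x p y \<longleftrightarrow>
     p \<noteq> [] \<and> hd p = x \<and> last p = y \<and> set p \<subseteq> V \<and> distinct p \<and> successively adj p"

(* The length of a path counts edges; the infimum of the empty set is infinity. *)
definition graph_metric :: "'a set \<Rightarrow> ('a \<Rightarrow> 'a \<Rightarrow> bool) \<Rightarrow> 'a \<Rightarrow> 'a \<Rightarrow> ennreal" where
  "graph_metric V adj x y = (INF p\<in>{p. graph_path V adj x p y}. of_nat (length p - 1))"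

definition ediam :: "('a \<Rightarrow> 'a \<Rightarrow> ennreal) \<Rightarrow> 'a set \<Rightarrow> ennreal" where
  "ediam \<rho> C = (SUP x\<in>C. SUP y\<in>C. \<rho> x y)"

definition ecball :: "'a set \<Rightarrow> ('a \<Rightarrow> 'a \<Rightarrow> ennreal) \<Rightarrow> 'a \<Rightarrow> real \<Rightarrow> 'a set" where
  "ecball X \<rho> x r = {y \<in> X. \<rho> x y \<le> ennreal r}"

definition borel_equiv :: "'a measure \<Rightarrow> ('a \<times> 'a) set \<Rightarrow> bool" where
  "borel_equiv M E \<longleftrightarrow> equiv (space M) E \<and> E \<in> sets (M \<Otimes>\<^sub>M M)"

definition uniformly_bounded :: "'a set \<Rightarrow> ('a \<Rightarrow> 'a \<Rightarrow> ennreal) \<Rightarrow> ('a \<times> 'a) set \<Rightarrow> bool" where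
  "uniformly_bounded X \<rho> E \<longleftrightarrow> (\<exists>D<\<infinity>. \<forall>C \<in> X // E. ediam \<rho> C \<le> D)"

definition borel_asdim_witness :: "'a measure \<Rightarrow> ('a \<Rightarrow> 'a \<Rightarrow> ennreal) \<Rightarrow> nat \<Rightarrow> bool" where
  "borel_asdim_witness M \<rho> d \<longleftrightarrow>
     (\<forall>r::real. r > 0 \<longrightarrow>
       (\<exists>E. borel_equiv M E \<and> uniformly_bounded (space M) \<rho> E \<and>
            (\<forall>x\<in>space M.
               finite {C \<in> space M // E. C \<inter> ecball (space M) \<rho> x r \<noteq> {}} \<and>
               card {C \<in> space M // E. C \<inter> ecball (space M) \<rho> x r \<noteq> {}} \<le> d + 1)))"

(* The infimum in enat is the least such d, and infinity if there is none. *)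
definition borel_asdim :: "'a measure \<Rightarrow> ('a \<Rightarrow> 'a \<Rightarrow> ennreal) \<Rightarrow> enat" where
  "borel_asdim M \<rho> = (INF d\<in>{d. borel_asdim_witness M \<rho> d}. enat d)"

end

theory Submission
  imports Defs
begin

text \<open>A segment of a forward orbit behaves like an interval, and a label that changes at most
  once along it accounts for the bound 1. A metric ball is carried into one such segment by a
  bounded forward shift, because points joined by a path have forward orbits that meet. The
  constraint that shapes the proof is that classes must be uniformly bounded. A countable Borel
  colouring comes for free, since countably many Borel sets isolate every point from finitely many
  others. But merging its classes into one set \<open>A\<close> delays the first hit a little for
  every class, so only finitely many classes can be merged within bounded time. Finiteness is where
  bounded fibres enter: they bound the number of forbidden colours. Short cycles need a separate
  transversal because a set with long return times contains none of their points. Novikov's theorem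
  is proved by its classical argument by contradiction; schemes of covers take the place of a change
  of topology.\<close>

text \<open>Choose \<open>A\<close> Borel such that a forward orbit that visits \<open>A\<close> returns only after more than \<open>R\<close>
  steps, and every forward orbit hits, in bounded time, either \<open>A\<close> or a fixed Borel transversal of
  the cycles of length at most \<open>R\<close>. Identifying points with the same first hit yields classes of
  bounded diameter, and the first hit takes at most two values along \<open>x, f x, \<dots>, f\<^sup>R x\<close>.
  Such an \<open>A\<close> comes from a finite Borel colouring of the graphs of the iterates of \<open>f\<close>, which is obtained
  from a countable one greedily. The greedy algorithm asks for images of Borel sets; it is
  enough to cover these by Borel sets whose multiplicity is bounded, and Novikov's separation theorem
  for analytic sets supplies such covers.\<close>

section \<open>Schemes of countable covers\<close>

text \<open>A coordinate \<open>l\<close> is a countable cover \<open>l 0, l 1, \<dots>\<close> of \<open>X\<close>, a branch \<open>\<beta>\<close> selects one member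
  \<open>l (\<beta> l)\<close> of each cover. Since coordinates are themselves the indices, schemes are merged by
  set union. A complete scheme plays the role of a Polish topology, and a set that it decides is clopen.\<close>

definition cell :: "'a set \<Rightarrow> (nat \<Rightarrow> 'a set) set \<Rightarrow> ((nat \<Rightarrow> 'a set) \<Rightarrow> nat) \<Rightarrow> 'a set" where
  "cell X F \<beta> = {x \<in> X. \<forall>l\<in>F. x \<in> l (\<beta> l)}"

definition consistent :: "'a set \<Rightarrow> (nat \<Rightarrow> 'a set) set \<Rightarrow> ((nat \<Rightarrow> 'a set) \<Rightarrow> nat) \<Rightarrow> bool" where
  "consistent X L \<beta> \<longleftrightarrow> (\<forall>F. finite F \<and> F \<subseteq> L \<longrightarrow> cell X F \<beta> \<noteq> {})"

definition complete_scheme :: "'a set \<Rightarrow> (nat \<Rightarrow> 'a set) set \<Rightarrow> bool" where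
  "complete_scheme X L \<longleftrightarrow> countable L \<and> (\<forall>l\<in>L. X \<subseteq> (\<Union>n. l n)) \<and>
     (\<forall>\<beta>. consistent X L \<beta> \<longrightarrow> cell X L \<beta> \<noteq> {})"

definition decides :: "'a set \<Rightarrow> (nat \<Rightarrow> 'a set) set \<Rightarrow> 'a set \<Rightarrow> bool" where
  "decides X L A \<longleftrightarrow> (\<forall>\<beta>. consistent X L \<beta> \<longrightarrow>
     (\<exists>F. finite F \<and> F \<subseteq> L \<and> (cell X F \<beta> \<subseteq> A \<or> cell X F \<beta> \<inter> A = {})))"

text \<open>Analogue of the Hausdorff property: complete schemes that extend a common rigid
  \<open>B\<close> have the same limit point along a common branch.\<close>

definition rigid :: "'a set \<Rightarrow> (nat \<Rightarrow> 'a set) set \<Rightarrow> bool" where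
  "rigid X B \<longleftrightarrow> (\<forall>\<beta> x y. x \<in> cell X B \<beta> \<longrightarrow> y \<in> cell X B \<beta> \<longrightarrow> x = y)"

text \<open>Corresponds to the sets that become clopen in some finer Polish topology. The base
  \<open>B\<close> stays fixed so that countably many refinements can be merged.\<close>

definition refinable :: "'a set \<Rightarrow> (nat \<Rightarrow> 'a set) set \<Rightarrow> 'a set \<Rightarrow> bool" where
  "refinable X B A \<longleftrightarrow> (\<exists>L. B \<subseteq> L \<and> complete_scheme X L \<and> decides X L A)"

lemma cell_antimono: "F \<subseteq> G \<Longrightarrow> cell X G \<beta> \<subseteq> cell X F \<beta>"
  by (auto simp: cell_def)

lemma consistent_mono: "consistent X L \<beta> \<Longrightarrow> K \<subseteq> L \<Longrightarrow> consistent X K \<beta>"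
  unfolding consistent_def by blast

lemma decides_mono: "decides X K A \<Longrightarrow> K \<subseteq> L \<Longrightarrow> decides X L A"
  unfolding decides_def by (meson consistent_mono order_trans)

text \<open>A branch consistent with the union is consistent with every \<open>K i\<close> and so
  has a point in each \<open>cell X (K i) \<beta>\<close>. All these points lie in one cell of
  \<open>B\<close>, hence coincide.\<close>

lemma complete_scheme_Union:
  assumes B: "rigid X B"
    and I: "countable I" "I \<noteq> {}"
    and K: "\<And>i. i \<in> I \<Longrightarrow> B \<subseteq> K i" "\<And>i. i \<in> I \<Longrightarrow> complete_scheme X (K i)"
  shows "complete_scheme X (\<Union>i\<in>I. K i)"
  unfolding complete_scheme_def
proof (intro conjI allI impI)
  show "countable (\<Union>i\<in>I. K i)" using I K by (auto simp: complete_scheme_def)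
  show "\<forall>l\<in>\<Union>i\<in>I. K i. X \<subseteq> (\<Union>n. l n)"
  proof
    fix l assume "l \<in> (\<Union>i\<in>I. K i)"
    then obtain i where "i \<in> I" "l \<in> K i" by blast
    then show "X \<subseteq> (\<Union>n. l n)" using K(2)[of i] unfolding complete_scheme_def by metis
  qed
  fix \<beta> assume c: "consistent X (\<Union>i\<in>I. K i) \<beta>"
  have "\<exists>x. x \<in> cell X (K i) \<beta>" if "i \<in> I" for i
  proof -
    have "K i \<subseteq> (\<Union>i\<in>I. K i)" using that by blast
    then have "consistent X (K i) \<beta>" using c consistent_mono by metis
    then have "cell X (K i) \<beta> \<noteq> {}" using K(2)[OF that] unfolding complete_scheme_def by metis
    then show ?thesis by blast
  qed
  then obtain x where x: "\<And>i. i \<in> I \<Longrightarrow> x i \<in> cell X (K i) \<beta>" by metis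
  obtain i0 where i0: "i0 \<in> I" using I by blast
  have "x i0 \<in> cell X (K i) \<beta>" if "i \<in> I" for i
  proof -
    have "x i \<in> cell X B \<beta>" "x i0 \<in> cell X B \<beta>"
      using x[OF that] x[OF i0] cell_antimono[OF K(1)[OF that]] cell_antimono[OF K(1)[OF i0]] by blast+
    then have "x i = x i0" using B unfolding rigid_def by metis
    then show ?thesis using x that by metis
  qed
  then have "x i0 \<in> cell X (\<Union>i\<in>I. K i) \<beta>" using i0 by (auto simp: cell_def)
  then show "cell X (\<Union>i\<in>I. K i) \<beta> \<noteq> {}" by blast
qed

lemma refinable_Union_family:
  fixes A :: "'i \<Rightarrow> 'a set"
  assumes B: "rigid X B" and I: "countable I" "I \<noteq> {}"
    and A: "\<And>i. i \<in> I \<Longrightarrow> refinable X B (A i)"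
  shows "\<exists>L. B \<subseteq> L \<and> complete_scheme X L \<and> (\<forall>i\<in>I. decides X L (A i))"
proof -
  obtain K where K: "\<And>i. i \<in> I \<Longrightarrow> B \<subseteq> K i" "\<And>i. i \<in> I \<Longrightarrow> complete_scheme X (K i)"
      "\<And>i. i \<in> I \<Longrightarrow> decides X (K i) (A i)"
    using A unfolding refinable_def by metis
  have "complete_scheme X (\<Union>i\<in>I. K i)" using complete_scheme_Union[OF B I] K by metis
  moreover have "decides X (\<Union>i\<in>I. K i) (A i)" if "i \<in> I" for i
    using decides_mono[OF K(3)[OF that]] that by blast
  ultimately show ?thesis using K(1) I by (intro exI[of _ "\<Union>i\<in>I. K i"]) blast
qed

lemma refinable_Diff:
  assumes "refinable X B A" shows "refinable X B (X - A)"
proof -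
  have "cell X F \<beta> \<subseteq> X" for F \<beta> by (auto simp: cell_def)
  then have "cell X F \<beta> \<subseteq> X - A \<longleftrightarrow> cell X F \<beta> \<inter> A = {}"
      "cell X F \<beta> \<inter> (X - A) = {} \<longleftrightarrow> cell X F \<beta> \<subseteq> A" for F \<beta> by blast+
  then have "decides X L (X - A)" if "decides X L A" for L
    using that unfolding decides_def by metis
  then show ?thesis using assms unfolding refinable_def by metis
qed

text \<open>The added coordinate names either one \<open>A i\<close> or the complement of the union.
  Each \<open>A i\<close> is clopen for \<open>K\<close>, so the named sets are closed, and the
  limit point found by \<open>K\<close> lies in the one that the branch selects: a finite cell
  deciding otherwise would contradict consistency.\<close>

lemma refinable_UNION:
  fixes A :: "nat \<Rightarrow> 'a set"
  assumes B: "rigid X B" and A: "\<And>i. refinable X B (A i)"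
  shows "refinable X B (\<Union>i. A i)"
proof -
  obtain K where K: "B \<subseteq> K" "complete_scheme X K" "\<And>i. decides X K (A i)"
    using refinable_Union_family[OF B, of UNIV A] A by auto
  define l where "l n = (case n of 0 \<Rightarrow> X - (\<Union>i. A i) | Suc i \<Rightarrow> A i)" for n
  have lS: "l 0 = X - (\<Union>i. A i)" "\<And>i. l (Suc i) = A i" by (auto simp: l_def)
  let ?L = "insert l K"
  have cov: "X \<subseteq> (\<Union>n. l n)"
  proof
    fix x assume "x \<in> X"
    then have "x \<in> l 0 \<or> (\<exists>i. x \<in> l (Suc i))" unfolding lS by blast
    then show "x \<in> (\<Union>n. l n)" by blast
  qed
  have "cell X ?L \<beta> \<noteq> {}" if c: "consistent X ?L \<beta>" for \<beta>
  proof -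
    have cK: "consistent X K \<beta>" using c consistent_mono subset_insertI by metis
    then have "cell X K \<beta> \<noteq> {}" using K(2) unfolding complete_scheme_def by metis
    then obtain x where x: "x \<in> cell X K \<beta>" by blast
    then have xX: "x \<in> X" by (auto simp: cell_def)
    have dec: "\<exists>F. finite F \<and> F \<subseteq> K \<and> x \<in> cell X F \<beta> \<and> (cell X F \<beta> \<subseteq> A i \<or> cell X F \<beta> \<inter> A i = {})" for i
    proof -
      obtain F where F: "finite F" "F \<subseteq> K" "cell X F \<beta> \<subseteq> A i \<or> cell X F \<beta> \<inter> A i = {}"
        using K(3)[of i] cK unfolding decides_def by metis
      moreover have "x \<in> cell X F \<beta>" using cell_antimono[OF F(2)] x by blast
      ultimately show ?thesis by blast
    qed
    have ne: "cell X (insert l F) \<beta> \<noteq> {}" if "finite F" "F \<subseteq> K" for F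
      using c[unfolded consistent_def, rule_format, of "insert l F"] that by auto
    have "x \<in> l (\<beta> l)"
    proof (cases "\<beta> l")
      case 0
      have "x \<notin> A i" for i
      proof
        assume "x \<in> A i"
        with dec[of i] obtain F where F: "finite F" "F \<subseteq> K" "cell X F \<beta> \<subseteq> A i" by blast
        from ne[OF F(1,2)] obtain y where "y \<in> cell X F \<beta>" "y \<in> l (\<beta> l)" by (auto simp: cell_def)
        with F 0 lS show False by auto
      qed
      with 0 xX lS show ?thesis by auto
    next
      case (Suc i)
      from dec[of i] obtain F where F: "finite F" "F \<subseteq> K" "x \<in> cell X F \<beta>"
        "cell X F \<beta> \<subseteq> A i \<or> cell X F \<beta> \<inter> A i = {}" by blast
      from ne[OF F(1,2)] obtain y where "y \<in> cell X F \<beta>" "y \<in> l (\<beta> l)" by (auto simp: cell_def)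
      with F Suc lS show ?thesis by auto
    qed
    with x have "x \<in> cell X ?L \<beta>" by (auto simp: cell_def)
    then show ?thesis by blast
  qed
  then have "complete_scheme X ?L" using K(2) cov unfolding complete_scheme_def by auto
  moreover have "decides X ?L (\<Union>i. A i)"
    unfolding decides_def
  proof (intro allI impI)
    fix \<beta>
    have "cell X {l} \<beta> \<subseteq> (\<Union>i. A i) \<or> cell X {l} \<beta> \<inter> (\<Union>i. A i) = {}"
      by (cases "\<beta> l") (auto simp: cell_def lS)
    then show "\<exists>F. finite F \<and> F \<subseteq> ?L \<and> (cell X F \<beta> \<subseteq> (\<Union>i. A i) \<or> cell X F \<beta> \<inter> (\<Union>i. A i) = {})"
      by (intro exI[of _ "{l}"]) auto
  qed
  ultimately show ?thesis using K(1) unfolding refinable_def by blast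
qed

text \<open>Cantor's intersection theorem: the balls make the closed sets \<open>C n\<close>
  arbitrarily small, and one further coordinate is harmless because its members are closed.\<close>

lemma (in Metric_space) closed_coordinate_complete:
  assumes mc: "mcomplete" and l: "\<And>m. closedin mtopology (l m)"
    and b: "b = (\<lambda>i m. mcball (D m) (1 / 2 ^ i))"
    and c: "consistent M (insert l (range b)) \<beta>"
  shows "cell M (insert l (range b)) \<beta> \<noteq> {}"
proof -
  define C where "C n = l (\<beta> l) \<inter> (\<Inter>i\<le>n. b i (\<beta> (b i)))" for n
  have ne: "C n \<noteq> {}" for n
  proof -
    have "finite (insert l (b ` {..n}))" "insert l (b ` {..n}) \<subseteq> insert l (range b)" by blast+
    then have "cell M (insert l (b ` {..n})) \<beta> \<noteq> {}"
      using c[unfolded consistent_def, rule_format, of "insert l (b ` {..n})"] by metis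
    then obtain x where "x \<in> cell M (insert l (b ` {..n})) \<beta>" by blast
    then have "x \<in> C n" unfolding C_def cell_def by blast
    then show ?thesis by blast
  qed
  have cl: "closedin mtopology (C n)" for n
    unfolding C_def by (intro closedin_Int closedin_INT) (auto simp: l b)
  have "decseq C" by (auto simp: decseq_def C_def)
  moreover have "\<exists>n a. C n \<subseteq> mcball a \<epsilon>" if e: "\<epsilon> > 0" for \<epsilon>
  proof -
    obtain n where n: "(1/2::real) ^ n < \<epsilon>" using real_arch_pow_inv[of \<epsilon> "1/2"] e by auto
    have "C n \<subseteq> b n (\<beta> (b n))" unfolding C_def by auto
    also have "\<dots> \<subseteq> mcball (D (\<beta> (b n))) \<epsilon>"
      unfolding b using n by (intro mcball_subset_concentric) (simp add: power_divide)
    finally show ?thesis by blast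
  qed
  ultimately have "\<Inter> (range C) \<noteq> {}" using mc ne cl unfolding mcomplete_nest by simp
  then obtain x where x: "\<And>n. x \<in> C n" by blast
  have "x \<in> M" using x cl closedin_subset topspace_mtopology by fastforce
  moreover have "x \<in> l (\<beta> l)" using x by (auto simp: C_def)
  moreover have "x \<in> b i (\<beta> (b i))" for i using x[of i] by (auto simp: C_def)
  ultimately have "x \<in> cell M (insert l (range b)) \<beta>" by (auto simp: cell_def)
  then show ?thesis by blast
qed

text \<open>An open set is a countable union of closed sets, so these pieces together with its
  complement form a coordinate with closed members.\<close>

lemma (in Metric_space) refinable_open:
  assumes mc: "mcomplete" and U: "openin mtopology U"
    and b: "b = (\<lambda>i m. mcball (D m) (1 / 2 ^ i))"
    and D: "\<And>x e. x \<in> M \<Longrightarrow> e > 0 \<Longrightarrow> \<exists>m. x \<in> mcball (D m) e"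
  shows "refinable M (range b) U"
proof -
  have "fsigma_in mtopology U" using open_imp_fsigma_in metrizable_space_mtopology U by blast
  then obtain C where C: "\<And>n::nat. closedin mtopology (C n)" "\<Union> (range C) = U"
    unfolding fsigma_in_ascending by blast
  define l where "l n = (case n of 0 \<Rightarrow> M - U | Suc i \<Rightarrow> C i)" for n
  have lS: "l 0 = M - U" "\<And>i. l (Suc i) = C i" by (auto simp: l_def)
  have cl: "closedin mtopology (l n)" for n
    using U C by (cases n) (auto simp: lS)
  have covl: "M \<subseteq> (\<Union>n. l n)"
  proof
    fix x assume "x \<in> M"
    then have "x \<in> l 0 \<or> (\<exists>i. x \<in> l (Suc i))" unfolding lS using C(2) by blast
    then show "x \<in> (\<Union>n. l n)" by blast
  qed
  have "M \<subseteq> (\<Union>n. b i n)" for i using D[of _ "1/2^i"] by (auto simp: b)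
  then have "complete_scheme M (insert l (range b))"
    using covl closed_coordinate_complete[OF mc cl b] unfolding complete_scheme_def by auto
  moreover have "decides M (insert l (range b)) U"
    unfolding decides_def
  proof (intro allI impI)
    fix \<beta>
    have "cell M {l} \<beta> \<subseteq> U \<or> cell M {l} \<beta> \<inter> U = {}"
      using C(2) by (cases "\<beta> l") (auto simp: cell_def lS)
    then show "\<exists>F. finite F \<and> F \<subseteq> insert l (range b) \<and> (cell M F \<beta> \<subseteq> U \<or> cell M F \<beta> \<inter> U = {})"
      by (intro exI[of _ "{l}"]) auto
  qed
  ultimately show ?thesis unfolding refinable_def by blast
qed

lemma (in Metric_space) rigid_balls:
  assumes b: "b = (\<lambda>i m. mcball (D m) (1 / 2 ^ i))"
  shows "rigid M (range b)"
  unfolding rigid_def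
proof (intro allI impI)
  fix \<beta> x y assume x: "x \<in> cell M (range b) \<beta>" and y: "y \<in> cell M (range b) \<beta>"
  then have xy: "x \<in> M" "y \<in> M" by (auto simp: cell_def)
  have le: "d x y \<le> 2 * (1/2) ^ n" for n
  proof -
    have "x \<in> mcball (D (\<beta> (b n))) (1/2^n)" "y \<in> mcball (D (\<beta> (b n))) (1/2^n)"
      using x y by (auto simp: cell_def b)
    then have "d (D (\<beta> (b n))) x \<le> 1/2^n" "d (D (\<beta> (b n))) y \<le> 1/2^n" "D (\<beta> (b n)) \<in> M"
      by auto
    then show ?thesis using triangle[of x "D (\<beta> (b n))" y] xy commute[of x "D (\<beta> (b n))"]
      by (simp add: power_divide)
  qed
  have "d x y = 0"
  proof (rule ccontr)
    assume "d x y \<noteq> 0"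
    then have "d x y / 2 > 0" using nonneg[of x y] by linarith
    then obtain n where "(1/2::real) ^ n < d x y / 2" using real_arch_pow_inv[of "d x y / 2" "1/2"] by auto
    with le[of n] show False by simp
  qed
  then show "x = y" using xy by simp
qed

lemma standard_borel_refinable:
  assumes "standard_borel M"
  shows "\<exists>B. rigid (space M) B \<and> (\<forall>A\<in>sets M. refinable (space M) B A)"
proof -
  obtain T where T: "topspace T = space M" "second_countable T" "completely_metrizable_space T"
     "sets M = sigma_sets (space M) {U. openin T U}" using assms unfolding standard_borel_def by blast
  obtain S d where S: "Metric_space S d" "Metric_space.mcomplete S d" "T = Metric_space.mtopology S d"
    using T(3) unfolding completely_metrizable_space_def by blast
  interpret Metric_space S d by fact
  have SM: "space M = S" using S(3) T(1) by simp
  obtain E where E: "countable E" "E \<subseteq> S" "mtopology closure_of E = S"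
    using second_countable_imp_separable_space[OF T(2)] unfolding separable_space_def S(3) by auto
  \<comment> \<open>If \<open>E\<close> is empty then so is \<open>S\<close>; the sequence is then
    arbitrary and the next claim vacuous.\<close>
  define D where "D = from_nat_into E"
  have D: "\<exists>m. x \<in> mcball (D m) e" if xe: "x \<in> S" "e > 0" for x e
  proof -
    have "x \<in> mtopology closure_of E" using xe E by simp
    then obtain y where y: "y \<in> E" "y \<in> mball x e"
      using xe(2) unfolding metric_closure_of by blast
    then have "x \<in> mcball y e" using commute by (auto simp: mball_def mcball_def)
    moreover obtain m where "D m = y" unfolding D_def using from_nat_into_surj[OF E(1) y(1)] by blast
    ultimately show ?thesis by blast
  qed
  define b where "b = (\<lambda>i m. mcball (D m) (1 / 2 ^ i))"
  have rig: "rigid S (range b)" using rigid_balls[OF b_def] .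
  have op: "refinable S (range b) U" if "openin T U" for U
    using refinable_open[OF S(2) _ b_def D] that S(3) by blast
  have "refinable S (range b) A" if "A \<in> sigma_sets S {U. openin T U}" for A
    using that
  proof induction
    case (Basic a) then show ?case using op by simp
  next
    case Empty then show ?case using op by simp
  next
    case (Compl a) then show ?case using refinable_Diff by blast
  next
    case (Union a) then show ?case using refinable_UNION[OF rig] by blast
  qed
  then show ?thesis using rig T(4) SM by metis
qed

section \<open>Novikov separation\<close>

text \<open>A singleton \<open>F\<close> serves to tell two values of a map apart; larger
  \<open>F\<close>, made of iterates of \<open>x\<close>, produce the countable colouring
  \<open>col\<close>.\<close>

definition separating :: "'a measure \<Rightarrow> (nat \<Rightarrow> 'a set) \<Rightarrow> bool" where
  "separating M U \<longleftrightarrow> range U \<subseteq> sets M \<and>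
     (\<forall>x\<in>space M. \<forall>F. finite F \<longrightarrow> x \<notin> F \<longrightarrow> (\<exists>n. x \<in> U n \<and> U n \<inter> F = {}))"

lemma standard_borel_separating:
  assumes "standard_borel M"
  shows "\<exists>U. separating M U"
proof -
  obtain T where T: "topspace T = space M" "second_countable T" "completely_metrizable_space T"
     "sets M = sigma_sets (space M) {U. openin T U}" using assms unfolding standard_borel_def by blast
  obtain \<B> where B: "countable \<B>" "\<And>V. V \<in> \<B> \<Longrightarrow> openin T V"
     "\<And>U x. openin T U \<Longrightarrow> x \<in> U \<Longrightarrow> \<exists>V\<in>\<B>. x \<in> V \<and> V \<subseteq> U"
    using T(2) unfolding second_countable_def by metis
  have t1: "t1_space T" using T(3) completely_metrizable_imp_metrizable_space metrizable_imp_t1_space by blast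
  \<comment> \<open>Adding the empty set makes the family nonempty, so that
    \<open>from_nat_into\<close> enumerates exactly this family.\<close>
  define U where "U = from_nat_into (insert {} \<B>)"
  have rU: "range U = insert {} \<B>" unfolding U_def using B(1) by (intro range_from_nat_into) auto
  have "range U \<subseteq> sets M" unfolding rU T(4) using B(2) by (auto intro: sigma_sets.Empty)
  moreover have "\<exists>n. x \<in> U n \<and> U n \<inter> F = {}" if "x \<in> space M" "finite F" "x \<notin> F" for x F
  proof -
    have "closedin T (space M \<inter> F)"
      using t1 that T(1) by (simp add: t1_space_closedin_finite)
    then have "openin T (space M - F)" using T(1) openin_diff[OF openin_topspace, of T "space M \<inter> F"]
      by (simp add: Diff_Int)
    moreover have "x \<in> space M - F" using that by blast
    ultimately obtain V where V: "V \<in> \<B>" "x \<in> V" "V \<subseteq> space M - F" using B(3) by metis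
    have "V \<in> range U" using rU V(1) by blast
    then obtain n where "U n = V" by blast
    then show ?thesis using V by blast
  qed
  ultimately show ?thesis unfolding separating_def by blast
qed

text \<open>For two indices this is Lusin's separation by disjoint measurable sets; in general only
  a point common to all the \<open>W i\<close> is forbidden.\<close>

definition separated_tuple :: "'b measure \<Rightarrow> 'i set \<Rightarrow> ('i \<Rightarrow> 'b set) \<Rightarrow> bool" where
  "separated_tuple N I P \<longleftrightarrow> (\<exists>W. (\<forall>i\<in>I. W i \<in> sets N \<and> P i \<subseteq> W i) \<and> (\<Inter>i\<in>I. W i) = {})"

lemma separated_tuple_antimono:
  assumes "separated_tuple N I P" "\<And>i. i \<in> I \<Longrightarrow> Q i \<subseteq> P i"
  shows "separated_tuple N I Q"
  using assms unfolding separated_tuple_def by (meson order_trans)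

text \<open>Combine the separators for the pieces \<open>Q n\<close> by a union at \<open>i0\<close>
  and by an intersection at every other index. The contrapositive is what gets used: a tuple that is
  not separated stays so for some piece.\<close>

lemma separated_tuple_split:
  assumes i0: "i0 \<in> I" and Q: "P i0 \<subseteq> (\<Union>n::nat. Q n)"
    and sep: "\<And>n. separated_tuple N I (P(i0 := Q n))"
  shows "separated_tuple N I P"
proof -
  have "\<forall>n. \<exists>W. (\<forall>i\<in>I. W i \<in> sets N \<and> (P(i0 := Q n)) i \<subseteq> W i) \<and> (\<Inter>i\<in>I. W i) = {}"
    using sep unfolding separated_tuple_def by blast
  from choice[OF this] obtain W where W: "\<And>n i. i \<in> I \<Longrightarrow> W n i \<in> sets N"
      "\<And>n i. i \<in> I \<Longrightarrow> (P(i0 := Q n)) i \<subseteq> W n i" "\<And>n. (\<Inter>i\<in>I. W n i) = {}"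
    by blast
  define V where "V i = (if i = i0 then (\<Union>n. W n i) else (\<Inter>n. W n i))" for i
  have "V i \<in> sets N" if "i \<in> I" for i
    using W(1)[OF that] unfolding V_def by auto
  moreover have "P i \<subseteq> V i" if "i \<in> I" for i
  proof (cases "i = i0")
    case True
    have "Q n \<subseteq> W n i0" for n using W(2)[OF i0, of n] by simp
    then show ?thesis using Q True unfolding V_def by fastforce
  next
    case False
    then have "P i \<subseteq> W n i" for n using W(2)[OF that, of n] by simp
    then show ?thesis using False unfolding V_def by auto
  qed
  moreover have "(\<Inter>i\<in>I. V i) = {}"
  proof (rule ccontr)
    assume "(\<Inter>i\<in>I. V i) \<noteq> {}"
    then obtain y where y: "\<And>i. i \<in> I \<Longrightarrow> y \<in> V i" by blast
    obtain n where n: "y \<in> W n i0" using y[OF i0] by (auto simp: V_def)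
    have "y \<in> W n i" if "i \<in> I" for i using y[OF that] n by (cases "i = i0") (auto simp: V_def)
    then show False using W(3)[of n] by blast
  qed
  ultimately show ?thesis unfolding separated_tuple_def by blast
qed

text \<open>Splitting is applied to the finitely many indices one after another. This is a single
  refinement step in the proof of Novikov's theorem.\<close>

lemma not_separated_refine:
  assumes I: "finite I" and ns: "\<not> separated_tuple N I (\<lambda>i. f ` P i)"
    and cov: "\<And>i. i \<in> I \<Longrightarrow> P i \<subseteq> (\<Union>n::nat. l n)"
  shows "\<exists>c. \<not> separated_tuple N I (\<lambda>i. f ` (P i \<inter> l (c i)))"
proof -
  have "\<exists>c. \<not> separated_tuple N I (\<lambda>i. if i \<in> J then f ` (P i \<inter> l (c i)) else f ` P i)"
    if "finite J" "J \<subseteq> I" for J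
    using that
  proof induction
    case empty
    then show ?case using ns by simp
  next
    case (insert j J)
    then obtain c where c: "\<not> separated_tuple N I (\<lambda>i. if i \<in> J then f ` (P i \<inter> l (c i)) else f ` P i)"
      (is "\<not> separated_tuple N I ?P") by auto
    have "?P j \<subseteq> (\<Union>n. f ` (P j \<inter> l n))" using insert cov by fastforce
    then obtain n where n: "\<not> separated_tuple N I (?P(j := f ` (P j \<inter> l n)))"
      using separated_tuple_split[of j I ?P "\<lambda>n. f ` (P j \<inter> l n)" N] c insert.prems by blast
    have "?P(j := f ` (P j \<inter> l n)) =
        (\<lambda>i. if i \<in> insert j J then f ` (P i \<inter> l ((c(j := n)) i)) else f ` P i)"
      using insert.hyps by (auto simp: fun_eq_iff)
    with n show ?case by (intro exI[of _ "c(j := n)"]) simp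
  qed
  from this[of I] I obtain c where
    c: "\<not> separated_tuple N I (\<lambda>i. if i \<in> I then f ` (P i \<inter> l (c i)) else f ` P i)" by auto
  show ?thesis
    using c separated_tuple_antimono[of N I "\<lambda>i. f ` (P i \<inter> l (c i))"
        "\<lambda>i. if i \<in> I then f ` (P i \<inter> l (c i)) else f ` P i"] by auto
qed

text \<open>A tuple that is not separated is refined along all coordinates of a complete scheme, and
  each entry converges to a point \<open>x i\<close> of \<open>A i\<close>. The images have no
  common point, so \<open>f (x i)\<close> and \<open>f (x j)\<close> differ for some
  \<open>i\<close>, \<open>j\<close>. Some \<open>U m\<close> contains the first and not the second,
  and at a finite stage \<open>U m\<close> and its complement already separate the tuple.\<close>

theorem novikov_separation:
  fixes I :: "'i set" and A :: "'i \<Rightarrow> 'a set"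
  assumes M: "standard_borel M" and f: "f \<in> M \<rightarrow>\<^sub>M N" and U: "separating N U"
    and I: "finite I" "I \<noteq> {}" and A: "\<And>i. i \<in> I \<Longrightarrow> A i \<in> sets M"
    and disj: "(\<Inter>i\<in>I. f ` A i) = {}"
  shows "separated_tuple N I (\<lambda>i. f ` A i)"
proof (rule ccontr)
  assume ns: "\<not> separated_tuple N I (\<lambda>i. f ` A i)"
  let ?X = "space M"
  have US: "U m \<in> sets N" for m using U unfolding separating_def by auto
  have AX: "A i \<subseteq> ?X" if "i \<in> I" for i using A[OF that] sets.sets_into_space by blast
  obtain B where B: "rigid ?X B" "\<And>A. A \<in> sets M \<Longrightarrow> refinable ?X B A"
    using standard_borel_refinable[OF M] by blast
  \<comment> \<open>In topological terms, deciding these sets makes every \<open>A i\<close> clopen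
    and \<open>f\<close> continuous with respect to the sets \<open>U m\<close>.\<close>
  define R where "R = A ` I \<union> range (\<lambda>m. f -` U m \<inter> ?X)"
  have "countable R" "R \<noteq> {}" using I(1) by (auto simp: R_def countable_finite)
  moreover have "refinable ?X B S" if "S \<in> R" for S
    using that A B(2) measurable_sets[OF f US] by (auto simp: R_def)
  ultimately obtain L where L: "complete_scheme ?X L" "\<And>S. S \<in> R \<Longrightarrow> decides ?X L S"
    using refinable_Union_family[OF B(1), of R "\<lambda>S. S"] by metis
  \<comment> \<open>The trivial coordinate keeps the enumerated family nonempty.\<close>
  define e where "e = from_nat_into (insert (\<lambda>_. ?X) L)"
  have cL: "countable (insert (\<lambda>_. ?X) L)" using L(1) by (simp add: complete_scheme_def)
  have re: "range e = insert (\<lambda>_. ?X) L" unfolding e_def by (rule range_from_nat_into[OF _ cL]) simp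
  have cov: "?X \<subseteq> (\<Union>n. e t n)" for t
  proof -
    have "e t \<in> insert (\<lambda>_. ?X) L" using re by blast
    then show ?thesis using L(1) unfolding complete_scheme_def by auto
  qed
  define Inv where "Inv t P \<longleftrightarrow> (t = (0::nat) \<longrightarrow> P = A) \<and> (\<forall>i\<in>I. P i \<subseteq> ?X) \<and>
      \<not> separated_tuple N I (\<lambda>i. f ` P i)" for t P
  define Step where "Step t P P' \<longleftrightarrow> (\<exists>c. \<forall>i. P' i = P i \<inter> e t (c i))"
    for t and P P' :: "'i \<Rightarrow> 'a set"
  have "\<exists>P. \<forall>t. Inv t (P t) \<and> Step t (P t) (P (Suc t))"
  proof (rule dependent_nat_choice)
    show "\<exists>P. Inv 0 P" using ns AX by (auto simp: Inv_def)
  next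
    fix P t assume "Inv t P"
    then have P: "\<And>i. i \<in> I \<Longrightarrow> P i \<subseteq> ?X" "\<not> separated_tuple N I (\<lambda>i. f ` P i)"
      by (auto simp: Inv_def)
    then obtain c where "\<not> separated_tuple N I (\<lambda>i. f ` (P i \<inter> e t (c i)))"
      using not_separated_refine[OF I(1) P(2), of "e t"] cov by blast
    then have "Inv (Suc t) (\<lambda>i. P i \<inter> e t (c i))" using P(1) by (auto simp: Inv_def)
    moreover have "Step t P (\<lambda>i. P i \<inter> e t (c i))" by (auto simp: Step_def)
    ultimately show "\<exists>P'. Inv (Suc t) P' \<and> Step t P P'" by blast
  qed
  then obtain P where P: "\<And>t. Inv t (P t)" "\<And>t. Step t (P t) (P (Suc t))" by blast
  then obtain c where c: "\<And>t i. P (Suc t) i = P t i \<inter> e t (c t i)"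
    unfolding Step_def by metis
  have P0: "P 0 = A" and PX: "\<And>t i. i \<in> I \<Longrightarrow> P t i \<subseteq> ?X"
    and Pns: "\<And>t. \<not> separated_tuple N I (\<lambda>i. f ` P t i)"
    using P(1) unfolding Inv_def by blast+
  have dec: "P t i \<subseteq> P s i" if "s \<le> t" for s t i
    using that by (rule lift_Suc_antimono_le[of "\<lambda>t. P t i", rotated]) (auto simp: c)
  have ne: "P t i \<noteq> {}" if "i \<in> I" for t i
  proof
    assume e: "P t i = {}"
    have "separated_tuple N I (\<lambda>i. f ` P t i)"
      unfolding separated_tuple_def
    proof (intro exI[of _ "\<lambda>j. if j = i then {} else space N"] conjI ballI)
      fix j assume "j \<in> I"
      then show "f ` P t j \<subseteq> (if j = i then {} else space N)"
        using e PX[of j t] measurable_space[OF f] by auto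
    qed (use that in auto)
    with Pns show False by blast
  qed
  \<comment> \<open>The enumeration may repeat a coordinate; the branches below read off the choice
    made at one fixed stage.\<close>
  define idx where "idx l = (SOME t. e t = l)" for l
  have idx: "e (idx l) = l" if "l \<in> L" for l
  proof -
    have "\<exists>t. e t = l" using re that by (metis insertCI imageE)
    then show ?thesis unfolding idx_def by (rule someI_ex)
  qed
  define \<beta> where "\<beta> i l = c (idx l) i" for i l
  have shrink: "\<exists>t. P t i \<subseteq> cell ?X F (\<beta> i)" if F: "finite F" "F \<subseteq> L" and i: "i \<in> I" for F i
  proof -
    obtain t where t: "\<And>l. l \<in> F \<Longrightarrow> idx l < t"
      using finite_nat_set_iff_bounded[of "idx ` F"] F by auto
    have "P t i \<subseteq> l (\<beta> i l)" if "l \<in> F" for l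
    proof -
      have "P t i \<subseteq> P (Suc (idx l)) i" using t[OF that] by (intro dec) simp
      also have "\<dots> \<subseteq> l (\<beta> i l)" using idx that F by (auto simp: c \<beta>_def)
      finally show ?thesis .
    qed
    then show ?thesis using PX[OF i] by (intro exI[of _ t]) (auto simp: cell_def)
  qed
  have cons: "consistent ?X L (\<beta> i)" if "i \<in> I" for i
    unfolding consistent_def using shrink ne that by (metis subset_empty)
  then have "\<exists>x. x \<in> cell ?X L (\<beta> i)" if "i \<in> I" for i
    using L(1) that unfolding complete_scheme_def by blast
  then obtain x where x: "\<And>i. i \<in> I \<Longrightarrow> x i \<in> cell ?X L (\<beta> i)" by metis
  have xX: "x i \<in> ?X" if "i \<in> I" for i using x[OF that] by (auto simp: cell_def)
  have decided: "\<exists>t. P t i \<subseteq> S \<and> x i \<in> S \<or> P t i \<inter> S = {} \<and> x i \<notin> S"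
    if i: "i \<in> I" and S: "S \<in> R" for i S
  proof -
    obtain F where F: "finite F" "F \<subseteq> L" "cell ?X F (\<beta> i) \<subseteq> S \<or> cell ?X F (\<beta> i) \<inter> S = {}"
      using L(2)[OF S] cons[OF i] unfolding decides_def by metis
    obtain t where t: "P t i \<subseteq> cell ?X F (\<beta> i)" using shrink[OF F(1,2) i] by blast
    have "x i \<in> cell ?X F (\<beta> i)" using x[OF i] cell_antimono[OF F(2)] by blast
    then show ?thesis using F(3) t by blast
  qed
  have xA: "x i \<in> A i" if i: "i \<in> I" for i
  proof (rule ccontr)
    assume n: "x i \<notin> A i"
    have "A i \<in> R" using i by (auto simp: R_def)
    then obtain t where "P t i \<inter> A i = {}" using decided[OF i, of "A i"] n by blast
    moreover have "P t i \<subseteq> A i" using dec[of 0 t i] P0 by simp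
    ultimately show False using ne[OF i] by blast
  qed
  have "\<exists>i\<in>I. \<exists>j\<in>I. f (x i) \<noteq> f (x j)"
  proof (rule ccontr)
    assume eq: "\<not> ?thesis"
    obtain i0 where "i0 \<in> I" using I by blast
    then have "f (x i0) \<in> f ` A i" if "i \<in> I" for i
      using eq that xA by (metis imageI)
    then show False using disj by blast
  qed
  then obtain i j where ij: "i \<in> I" "j \<in> I" "f (x i) \<noteq> f (x j)" by blast
  then obtain m where m: "f (x i) \<in> U m" "U m \<inter> {f (x j)} = {}"
    using U measurable_space[OF f xX[OF ij(1)]] unfolding separating_def
    by (metis finite.emptyI finite.insertI singletonD)
  have mR: "f -` U m \<inter> ?X \<in> R" by (auto simp: R_def)
  obtain s where s: "P s i \<subseteq> f -` U m \<inter> ?X" using decided[OF ij(1) mR] m xX ij by blast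
  obtain t where t: "P t j \<inter> (f -` U m \<inter> ?X) = {}" using decided[OF ij(2) mR] m xX ij by blast
  let ?u = "max s t"
  have "separated_tuple N I (\<lambda>i. f ` P ?u i)"
    unfolding separated_tuple_def
  proof (intro exI[of _ "\<lambda>k. if k = i then U m else if k = j then space N - U m else space N"] conjI ballI)
    fix k assume k: "k \<in> I"
    have "f ` P ?u i \<subseteq> U m" using s dec[of s ?u i] by auto
    moreover have "f ` P ?u j \<inter> U m = {}" using t dec[of t ?u j] PX[OF ij(2), of ?u] by auto
    moreover have "f ` P ?u k \<subseteq> space N" using PX[OF k] measurable_space[OF f] by blast
    ultimately show "f ` P ?u k \<subseteq> (if k = i then U m else if k = j then space N - U m else space N)"
      by auto
  next
    show "(\<Inter>k\<in>I. if k = i then U m else if k = j then space N - U m else space N) = {}"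
    proof (rule ccontr)
      assume "\<not> ?thesis"
      then obtain y where y: "\<And>k. k \<in> I \<Longrightarrow> y \<in> (if k = i then U m else if k = j then space N - U m else space N)"
        by blast
      show False using y[OF ij(1)] y[OF ij(2)] ij(3) by (auto split: if_splits)
    qed
  qed (use US in auto)
  then show False using Pns by blast
qed

text \<open>A point common to \<open>K + 1\<close> of the images would have \<open>K + 1\<close>
  preimages, one in each of the disjoint sets \<open>C j\<close>. Hence Novikov's theorem separates
  every \<open>K + 1\<close> of the images with index below \<open>J\<close>, and \<open>V j\<close>
  is the intersection of all separators obtained for the index \<open>j\<close>. A point in
  \<open>K + 1\<close> of the \<open>V j\<close> would lie in a full tuple of separators.\<close>

lemma image_cover_bounded_multiplicity:
  assumes M: "standard_borel M" and h: "h \<in> M \<rightarrow>\<^sub>M N" and U: "separating N U"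
    and K: "\<And>y. y \<in> space N \<Longrightarrow> finite {x \<in> space M. h x = y} \<and> card {x \<in> space M. h x = y} \<le> K"
    and C: "\<And>j::nat. C j \<in> sets M" and disj: "disjoint_family C"
  shows "\<exists>V. (\<forall>j. V j \<in> sets N \<and> h ` C j \<subseteq> V j) \<and>
     (\<forall>y\<in>space N. card {j\<in>{..<J}. y \<in> V j} \<le> K)"
proof -
  have CX: "C j \<subseteq> space M" for j using C sets.sets_into_space by blast
  define \<S> where "\<S> = {I. I \<subseteq> {..<J} \<and> card I = Suc K}"
  have finS: "finite \<S>" unfolding \<S>_def by (rule finite_subset[of _ "Pow {..<J}"]) auto
  have "separated_tuple N I (\<lambda>j. h ` C j)" if "I \<in> \<S>" for I
  proof -
    have I: "finite I" "card I = Suc K" using that finite_subset unfolding \<S>_def by auto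
    have "(\<Inter>j\<in>I. h ` C j) = {}"
    proof (rule ccontr)
      assume "(\<Inter>j\<in>I. h ` C j) \<noteq> {}"
      then obtain y where y: "\<And>j. j \<in> I \<Longrightarrow> y \<in> h ` C j" by blast
      then have "\<forall>j\<in>I. \<exists>x. x \<in> C j \<and> h x = y" by blast
      then obtain x where x: "\<And>j. j \<in> I \<Longrightarrow> x j \<in> C j" "\<And>j. j \<in> I \<Longrightarrow> h (x j) = y" by metis
      have "inj_on x I"
        using x(1) disj unfolding inj_on_def disjoint_family_on_def by (metis UNIV_I disjoint_iff)
      moreover have "x ` I \<subseteq> {z \<in> space M. h z = y}" using x CX by blast
      moreover obtain j where "j \<in> I" using I by fastforce
      then have y: "y \<in> space N" using x CX measurable_space[OF h] by blast
      ultimately have "card I \<le> card {z \<in> space M. h z = y}"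
        using K[OF y] by (intro card_inj_on_le) auto
      also have "\<dots> \<le> K" using K[OF y] by blast
      finally show False using I by simp
    qed
    moreover have "I \<noteq> {}" using I by auto
    ultimately show ?thesis using novikov_separation[OF M h U I(1)] C by blast
  qed
  then obtain W where W: "\<And>I j. I \<in> \<S> \<Longrightarrow> j \<in> I \<Longrightarrow> W I j \<in> sets N"
     "\<And>I j. I \<in> \<S> \<Longrightarrow> j \<in> I \<Longrightarrow> h ` C j \<subseteq> W I j" "\<And>I. I \<in> \<S> \<Longrightarrow> (\<Inter>j\<in>I. W I j) = {}"
    unfolding separated_tuple_def by metis
  \<comment> \<open>If \<open>j\<close> belongs to no member of \<open>\<S>\<close>, the
    intersection over the empty family is \<open>UNIV\<close>, and \<open>V j\<close> becomes
    \<open>space N\<close>.\<close>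
  define V where "V j = space N \<inter> (\<Inter>I\<in>{I\<in>\<S>. j \<in> I}. W I j)" for j
  have "V j \<in> sets N" for j
  proof (cases "{I\<in>\<S>. j \<in> I} = {}")
    case True then show ?thesis unfolding V_def True by simp
  next
    case False
    have "(\<Inter>I\<in>{I\<in>\<S>. j \<in> I}. W I j) \<in> sets N"
      using finS False W(1) by (intro sets.finite_INT) auto
    then show ?thesis unfolding V_def by auto
  qed
  moreover have "h ` C j \<subseteq> V j" for j
  proof -
    have "h ` C j \<subseteq> space N" using CX[of j] measurable_space[OF h] by blast
    moreover have "h ` C j \<subseteq> W I j" if "I \<in> {I\<in>\<S>. j \<in> I}" for I using that W(2) by simp
    ultimately show ?thesis unfolding V_def by (intro Int_greatest INT_greatest)
  qed
  moreover have "card {j\<in>{..<J}. y \<in> V j} \<le> K" for y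
  proof (rule ccontr)
    assume "\<not> card {j\<in>{..<J}. y \<in> V j} \<le> K"
    then obtain I where I: "I \<subseteq> {j\<in>{..<J}. y \<in> V j}" "card I = Suc K"
      by (metis not_less_eq_eq obtain_subset_with_card_n)
    then have IS: "I \<in> \<S>" unfolding \<S>_def by blast
    have "y \<in> W I j" if j: "j \<in> I" for j
    proof -
      have "y \<in> V j" using j I(1) by blast
      then show ?thesis using j IS by (simp add: V_def)
    qed
    then show False using W(3)[OF IS] by blast
  qed
  ultimately show ?thesis by blast
qed

section \<open>Finite Borel colourings\<close>

text \<open>The two values differ exactly when some \<open>U n\<close> contains \<open>g x\<close>
  but not \<open>h x\<close>, which is a countable union of measurable conditions.\<close>

lemma sets_Collect_eq_separating:
  assumes U: "separating M U" and g: "g \<in> N \<rightarrow>\<^sub>M M" and h: "h \<in> N \<rightarrow>\<^sub>M M"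
  shows "{x \<in> space N. g x = h x} \<in> sets N"
proof -
  have U': "U n \<in> sets M" for n using U by (auto simp: separating_def)
  have "g x = h x" if x: "x \<in> space N" "\<And>n. g x \<in> U n \<Longrightarrow> h x \<in> U n" for x
  proof (rule ccontr)
    assume "g x \<noteq> h x"
    then obtain n where "g x \<in> U n" "U n \<inter> {h x} = {}"
      using U measurable_space[OF g x(1)] unfolding separating_def
      by (metis finite.emptyI finite.insertI singletonD)
    then show False using x(2) by blast
  qed
  then have "{x \<in> space N. g x = h x} =
      space N - (\<Union>n. (g -` U n \<inter> space N) - (h -` U n \<inter> space N))" by auto
  also have "\<dots> \<in> sets N"
    using measurable_sets[OF g U'] measurable_sets[OF h U'] by auto
  finally show ?thesis .
qed

text \<open>Independence in the graph of \<open>h\<close>, loops included: no fixed point of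
  \<open>h\<close> lies in such a set.\<close>

definition self_disjoint :: "('a \<Rightarrow> 'a) \<Rightarrow> 'a set \<Rightarrow> bool" where
  "self_disjoint h B \<longleftrightarrow> (\<forall>x\<in>B. h x \<notin> B)"

lemma self_disjoint_subset: "self_disjoint h B \<Longrightarrow> A \<subseteq> B \<Longrightarrow> self_disjoint h A"
  by (auto simp: self_disjoint_def)

text \<open>A point of \<open>B\<close> has at most \<open>K + 1\<close> forbidden colours: at most \<open>K\<close> because of its preimages,
  for which the sets \<open>V j\<close> serve as measurable upper bounds of the images \<open>h ` C j\<close>, and one
  because of its own image.\<close>

lemma greedy_colouring_step:
  fixes C :: "nat \<Rightarrow> 'a set"
  assumes M: "standard_borel M" "separating M U" and h: "h \<in> M \<rightarrow>\<^sub>M M"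
    and K: "\<And>y. y \<in> space M \<Longrightarrow> finite {x \<in> space M. h x = y} \<and> card {x \<in> space M. h x = y} \<le> K"
    and C: "\<And>j. C j \<in> sets M" "disjoint_family C" "\<And>j. self_disjoint h (C j)"
    and B: "B \<in> sets M" "self_disjoint h B" "\<And>j. B \<inter> C j = {}"
  shows "\<exists>C'. (\<forall>j. C' j \<in> sets M) \<and> disjoint_family C' \<and> (\<forall>j. self_disjoint h (C' j)) \<and>
    (\<forall>j. C j \<subseteq> C' j \<and> C' j \<subseteq> C j \<union> B) \<and> B \<subseteq> (\<Union>j<K+2. C' j)"
proof -
  obtain V where V: "\<And>j. V j \<in> sets M" "\<And>j. h ` C j \<subseteq> V j"
    "\<And>y. y \<in> space M \<Longrightarrow> card {j\<in>{..<K+2}. y \<in> V j} \<le> K"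
    using image_cover_bounded_multiplicity[OF M(1) h M(2) K C(1,2), where J = "K+2"] by blast
  define adm where "adm y j \<longleftrightarrow> y \<notin> V j \<and> h y \<notin> C j" for y j
  define D where "D j = {y \<in> B. adm y j \<and> (\<forall>i<j. \<not> adm y i)}" for j
  have BX: "B \<subseteq> space M" using B(1) sets.sets_into_space by blast
  have admS: "{y \<in> B. adm y j} \<in> sets M" for j
  proof -
    have "{y \<in> B. adm y j} = B - V j - (h -` C j \<inter> space M)"
      using BX by (auto simp: adm_def)
    also have "\<dots> \<in> sets M" using B(1) V(1) measurable_sets[OF h C(1)] by auto
    finally show ?thesis .
  qed
  have DS: "D j \<in> sets M" for j
  proof -
    have "D j = {y \<in> B. adm y j} - (\<Union>i<j. {y \<in> B. adm y i})" by (auto simp: D_def)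
    also have "\<dots> \<in> sets M" using admS by auto
    finally show ?thesis .
  qed
  have DB: "D j \<subseteq> B" for j by (auto simp: D_def)
  have Ddis: "D i \<inter> D j = {}" if "i < j" for i j using that by (auto simp: D_def)
  have Dd: "D i \<inter> D j = {}" if "i \<noteq> j" for i j
    using Ddis[of i j] Ddis[of j i] that by (cases "i < j") auto
  have cover: "\<exists>j<K+2. y \<in> D j" if y: "y \<in> B" for y
  proof -
    have yX: "y \<in> space M" using y BX by blast
    have "\<exists>j<K+2. adm y j"
    proof (rule ccontr)
      assume "\<not> ?thesis"
      then have sub: "{..<K+2} \<subseteq> {j\<in>{..<K+2}. y \<in> V j} \<union> {j\<in>{..<K+2}. h y \<in> C j}"
        by (auto simp: adm_def)
      have "card {j\<in>{..<K+2}. h y \<in> C j} \<le> 1"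
      proof (rule card_le_Suc0_iff_eq[THEN iffD2, folded One_nat_def])
        show "\<forall>a\<in>{j \<in> {..<K+2}. h y \<in> C j}. \<forall>b\<in>{j \<in> {..<K+2}. h y \<in> C j}. a = b"
          using C(2) unfolding disjoint_family_on_def by blast
      qed simp
      then have "card ({j\<in>{..<K+2}. y \<in> V j} \<union> {j\<in>{..<K+2}. h y \<in> C j}) \<le> K + 1"
        using V(3)[OF yX] card_Un_le[of "{j\<in>{..<K+2}. y \<in> V j}" "{j\<in>{..<K+2}. h y \<in> C j}"]
        by linarith
      moreover have "card {..<K+2} \<le> card ({j\<in>{..<K+2}. y \<in> V j} \<union> {j\<in>{..<K+2}. h y \<in> C j})"
        using sub by (intro card_mono) auto
      ultimately show False by simp
    qed
    then obtain j where j: "j < K+2" "adm y j" by blast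
    define i where "i = (LEAST i. adm y i)"
    have "adm y i" "\<And>l. l < i \<Longrightarrow> \<not> adm y l" unfolding i_def using j(2) by (auto intro: LeastI dest: not_less_Least)
    moreover have "i \<le> j" unfolding i_def using j(2) by (rule Least_le)
    ultimately show ?thesis using y j(1) by (intro exI[of _ i]) (auto simp: D_def)
  qed
  have "self_disjoint h (C j \<union> D j)" for j
    unfolding self_disjoint_def
  proof (intro ballI notI)
    fix x assume x: "x \<in> C j \<union> D j" and hx: "h x \<in> C j \<union> D j"
    consider "x \<in> C j" "h x \<in> C j" | "x \<in> C j" "h x \<in> D j" | "x \<in> D j" "h x \<in> C j"
      | "x \<in> D j" "h x \<in> D j" using x hx by blast
    then show False
    proof cases
      case 1 then show ?thesis using C(3) by (auto simp: self_disjoint_def)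
    next
      case 2 then show ?thesis using V(2)[of j] by (auto simp: D_def adm_def)
    next
      case 3 then show ?thesis by (auto simp: D_def adm_def)
    next
      case 4 then show ?thesis using B(2) DB[of j] by (auto simp: self_disjoint_def)
    qed
  qed
  moreover have "disjoint_family (\<lambda>j. C j \<union> D j)"
    unfolding disjoint_family_on_def
  proof (intro ballI impI)
    fix i j :: nat assume ij: "i \<noteq> j"
    have "C i \<inter> C j = {}" using C(2) ij unfolding disjoint_family_on_def by blast
    moreover have "D i \<inter> C j = {}" "C i \<inter> D j = {}" using DB[of i] DB[of j] B(3)[of i] B(3)[of j] by blast+
    ultimately show "(C i \<union> D i) \<inter> (C j \<union> D j) = {}" using Dd[OF ij] by blast
  qed
  moreover have "B \<subseteq> (\<Union>j<K+2. C j \<union> D j)" using cover by blast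
  ultimately show ?thesis
    using DS C(1) DB by (intro exI[of _ "\<lambda>j. C j \<union> D j"] conjI allI) (blast intro: sets.Un)+
qed

text \<open>The classes \<open>B n\<close>, made disjoint, are recoloured one at a time while the
  new classes only grow. In the limit independence survives because \<open>x\<close> and
  \<open>h x\<close> would both have entered a class by some finite stage.\<close>

lemma finite_colouring_of_countable:
  fixes B :: "nat \<Rightarrow> 'a set"
  assumes M: "standard_borel M" "separating M U" and h: "h \<in> M \<rightarrow>\<^sub>M M"
    and K: "\<And>y. y \<in> space M \<Longrightarrow> finite {x \<in> space M. h x = y} \<and> card {x \<in> space M. h x = y} \<le> K"
    and B: "\<And>n. B n \<in> sets M" "\<And>n. self_disjoint h (B n)"
  shows "\<exists>C. (\<forall>j. C j \<in> sets M) \<and> (\<forall>j. self_disjoint h (C j)) \<and> (\<Union>n. B n) \<subseteq> (\<Union>j<K+2. C j)"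
proof -
  define B' where "B' = disjointed B"
  have B'S: "B' n \<in> sets M" for n
    unfolding B'_def disjointed_def using B(1) by auto
  have B'B: "B' n \<subseteq> B n" for n unfolding B'_def by (rule disjointed_subset)
  have B'i: "self_disjoint h (B' n)" for n using self_disjoint_subset[OF B(2) B'B] .
  have B'd: "B' n \<inter> B' m = {}" if "m < n" for m n
    using disjoint_family_disjointed[of B] that unfolding disjoint_family_on_def B'_def
    by (metis UNIV_I less_irrefl)
  have UB: "(\<Union>n. B' n) = (\<Union>n. B n)" unfolding B'_def by (rule UN_disjointed_eq)
  define Inv where "Inv n C \<longleftrightarrow> (\<forall>j. C j \<in> sets M) \<and> disjoint_family C \<and> (\<forall>j. self_disjoint h (C j)) \<and>
      (\<forall>j. C j \<subseteq> (\<Union>m<n. B' m))" for n and C :: "nat \<Rightarrow> 'a set"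
  define Step where "Step n C C' \<longleftrightarrow> (\<forall>j. C j \<subseteq> C' j) \<and> B' n \<subseteq> (\<Union>j<K+2. C' j)"
    for n and C C' :: "nat \<Rightarrow> 'a set"
  have "\<exists>C. \<forall>n. Inv n (C n) \<and> Step n (C n) (C (Suc n))"
  proof (rule dependent_nat_choice)
    have "Inv 0 (\<lambda>_. {})" by (auto simp: Inv_def self_disjoint_def disjoint_family_on_def)
    then show "\<exists>C. Inv 0 C" by blast
  next
    fix C n assume "Inv n C"
    then have C: "\<And>j. C j \<in> sets M" "disjoint_family C" "\<And>j. self_disjoint h (C j)"
      "\<And>j. C j \<subseteq> (\<Union>m<n. B' m)" by (auto simp: Inv_def)
    have dB: "B' n \<inter> C j = {}" for j
    proof -
      have "B' n \<inter> (\<Union>m<n. B' m) = {}" using B'd by blast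
      then show ?thesis using C(4)[of j] by blast
    qed
    obtain C' where C': "\<And>j. C' j \<in> sets M" "disjoint_family C'" "\<And>j. self_disjoint h (C' j)"
      "\<And>j. C j \<subseteq> C' j" "\<And>j. C' j \<subseteq> C j \<union> B' n" "B' n \<subseteq> (\<Union>j<K+2. C' j)"
      using greedy_colouring_step[OF M h K C(1-3) B'S[of n] B'i dB] by metis
    have "C' j \<subseteq> (\<Union>m<Suc n. B' m)" for j
      using C'(5)[of j] C(4)[of j] unfolding lessThan_Suc by blast
    then have "Inv (Suc n) C'" using C' by (auto simp: Inv_def)
    moreover have "Step n C C'" using C'(4,6) unfolding Step_def by blast
    ultimately show "\<exists>C'. Inv (Suc n) C' \<and> Step n C C'" by blast
  qed
  then obtain C where Ca: "\<And>n. Inv n (C n)" and Cb: "\<And>n. Step n (C n) (C (Suc n))" by blast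
  have C: "\<And>n j. C n j \<in> sets M" "\<And>n j. self_disjoint h (C n j)"
    using Ca unfolding Inv_def by blast+
  have mono: "C n j \<subseteq> C m j" if "n \<le> m" for n m j
    using that by (rule lift_Suc_mono_le[of "\<lambda>n. C n j", rotated]) (use Cb in \<open>auto simp: Step_def\<close>)
  have "self_disjoint h (\<Union>n. C n j)" for j
    unfolding self_disjoint_def
  proof (intro ballI notI)
    fix x assume "x \<in> (\<Union>n. C n j)" "h x \<in> (\<Union>n. C n j)"
    then obtain n m where "x \<in> C n j" "h x \<in> C m j" by blast
    then have "x \<in> C (max n m) j" "h x \<in> C (max n m) j" using mono[of n "max n m" j] mono[of m "max n m" j] by auto
    then show False using C(2) by (auto simp: self_disjoint_def)
  qed
  moreover have "(\<Union>n. C n j) \<in> sets M" for j using C(1) by auto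
  moreover have "(\<Union>n. B n) \<subseteq> (\<Union>j<K+2. \<Union>n. C n j)"
  proof -
    have "B' n \<subseteq> (\<Union>j<K+2. \<Union>n. C n j)" for n
    proof -
      have "B' n \<subseteq> (\<Union>j<K+2. C (Suc n) j)" using Cb[of n] unfolding Step_def by blast
      then show ?thesis by blast
    qed
    then show ?thesis unfolding UB[symmetric] by blast
  qed
  ultimately show ?thesis by (intro exI[of _ "\<lambda>j. \<Union>n. C n j"]) blast
qed

section \<open>Colourings and separated covers for the iterates of a bounded-to-one map\<close>

locale bounded_to_one_map =
  fixes M :: "'a measure" and U :: "nat \<Rightarrow> 'a set" and f :: "'a \<Rightarrow> 'a" and k :: nat
  assumes sb: "standard_borel M" and sep: "separating M U" and f: "f \<in> M \<rightarrow>\<^sub>M M"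
    and fibre: "\<And>y. y \<in> space M \<Longrightarrow> finite {x \<in> space M. f x = y} \<and> card {x \<in> space M. f x = y} \<le> k"
begin

lemma funpow_measurable [measurable]: "f ^^ i \<in> M \<rightarrow>\<^sub>M M"
proof (induction i)
  case (Suc i)
  then show ?case using measurable_comp[OF Suc f] by (simp only: funpow.simps)
qed (simp add: id_def)

lemma funpow_space: "x \<in> space M \<Longrightarrow> (f ^^ i) x \<in> space M"
  using measurable_space[OF funpow_measurable] .

lemma funpow_fibre:
  assumes "y \<in> space M"
  shows "finite {x \<in> space M. (f ^^ i) x = y} \<and> card {x \<in> space M. (f ^^ i) x = y} \<le> k ^ i"
proof (induction i)
  case 0
  have "{x \<in> space M. (f ^^ 0) x = y} = {y}" using assms by auto
  then show ?case by simp
next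
  case (Suc i)
  let ?Z = "{z \<in> space M. (f ^^ i) z = y}"
  have eq: "{x \<in> space M. (f ^^ Suc i) x = y} = (\<Union>z\<in>?Z. {x \<in> space M. f x = z})"
    using measurable_space[OF f] by (auto simp: funpow_swap1)
  have "card (\<Union>z\<in>?Z. {x \<in> space M. f x = z}) \<le> (\<Sum>z\<in>?Z. card {x \<in> space M. f x = z})"
    using Suc by (intro card_UN_le) auto
  also have "\<dots> \<le> (\<Sum>z\<in>?Z. k)" using fibre by (intro sum_mono) auto
  also have "\<dots> \<le> k ^ Suc i" using Suc by simp
  finally show ?case unfolding eq using Suc fibre by auto
qed

lemma sets_funpow_fixed: "{x \<in> space M. (f ^^ i) x = x} \<in> sets M"
  using sets_Collect_eq_separating[OF sep funpow_measurable, of "\<lambda>x. x"] by simp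

text \<open>A countable colouring of the graphs of all \<open>f ^^ i\<close> with
  \<open>i \<le> R\<close> at once. Iterates equal to \<open>x\<close> are exempt so that points on
  short cycles receive a colour too.\<close>

definition col :: "nat \<Rightarrow> 'a \<Rightarrow> nat" where
  "col R x = (LEAST n. x \<in> U n \<and> (\<forall>i\<le>R. (f ^^ i) x \<noteq> x \<longrightarrow> (f ^^ i) x \<notin> U n))"

lemma col_measurable [measurable]: "col R \<in> M \<rightarrow>\<^sub>M count_space UNIV"
proof -
  have [measurable]: "U n \<in> sets M" for n using sep by (auto simp: separating_def)
  have [measurable]: "Measurable.pred M (\<lambda>x. (f ^^ i) x = x)" for i
    using sets_funpow_fixed by (simp add: pred_def)
  show ?thesis unfolding col_def by measurable
qed

text \<open>With equal colours, \<open>U (col R x)\<close> would contain \<open>(f ^^ i) x\<close>,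
  which it was chosen to avoid.\<close>

lemma col_neq:
  assumes x: "x \<in> space M" and i: "i \<le> R" "(f ^^ i) x \<noteq> x"
  shows "col R ((f ^^ i) x) \<noteq> col R x"
proof
  assume eq: "col R ((f ^^ i) x) = col R x"
  let ?P = "\<lambda>x n. x \<in> U n \<and> (\<forall>i\<le>R. (f ^^ i) x \<noteq> x \<longrightarrow> (f ^^ i) x \<notin> U n)"
  have ex: "?P y (col R y)" if y: "y \<in> space M" for y
  proof -
    have "finite ((\<lambda>i. (f ^^ i) y) ` {..R} - {y})" "y \<notin> (\<lambda>i. (f ^^ i) y) ` {..R} - {y}" by auto
    then obtain n where "y \<in> U n" "U n \<inter> ((\<lambda>i. (f ^^ i) y) ` {..R} - {y}) = {}"
      using sep y unfolding separating_def by metis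
    then have "?P y n" by blast
    then show ?thesis unfolding col_def by (rule LeastI)
  qed
  have "(f ^^ i) x \<in> U (col R x)" using ex[OF funpow_space[OF x, of i]] eq by simp
  then show False using ex[OF x] i by blast
qed

definition periodic :: "nat \<Rightarrow> 'a set" where
  "periodic R = {x \<in> space M. \<exists>p\<in>{1..R}. (f ^^ p) x = x}"

lemma periodic_sets [measurable]: "periodic R \<in> sets M"
proof -
  have "periodic R = (\<Union>p\<in>{1..R}. {x \<in> space M. (f ^^ p) x = x})" by (auto simp: periodic_def)
  then show ?thesis using sets_funpow_fixed by auto
qed

text \<open>The common refinement of one finite colouring for each of \<open>f\<close>, ...,
  \<open>f ^^ S\<close>. Off \<open>periodic R\<close> these iterates move every point, so the
  classes of \<open>col R\<close> are independent and can be recoloured. The number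
  \<open>k ^ Suc S + 2\<close> comes from the bound \<open>k ^ Suc S\<close> on the fibres of
  \<open>f ^^ Suc S\<close>.\<close>

lemma finite_separated_cover:
  assumes "S \<le> R"
  shows "\<exists>\<Q>. finite \<Q> \<and> \<Q> \<subseteq> sets M \<and> space M - periodic R \<subseteq> \<Union>\<Q> \<and>
    (\<forall>Q\<in>\<Q>. \<forall>i\<in>{1..S}. self_disjoint (f ^^ i) Q)"
  using assms
proof (induction S)
  case 0
  show ?case by (intro exI[of _ "{space M}"]) auto
next
  case (Suc S)
  then obtain \<Q> where Q: "finite \<Q>" "\<Q> \<subseteq> sets M" "space M - periodic R \<subseteq> \<Union>\<Q>"
    "\<And>Q i. Q \<in> \<Q> \<Longrightarrow> i \<in> {1..S} \<Longrightarrow> self_disjoint (f ^^ i) Q" by auto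
  define B where "B n = {x \<in> space M - periodic R. col R x = n}" for n
  have "B n \<in> sets M" for n unfolding B_def by measurable
  moreover have "self_disjoint (f ^^ Suc S) (B n)" for n
    unfolding self_disjoint_def
  proof (intro ballI notI)
    fix x assume x: "x \<in> B n" and fx: "(f ^^ Suc S) x \<in> B n"
    have "Suc S \<in> {1..R}" using Suc.prems by simp
    then have "x \<in> space M" "(f ^^ Suc S) x \<noteq> x"
      using x unfolding B_def periodic_def by blast+
    then have "col R ((f ^^ Suc S) x) \<noteq> col R x" using col_neq Suc.prems by blast
    then show False using x fx by (auto simp: B_def)
  qed
  ultimately obtain C where C: "\<And>j. C j \<in> sets M" "\<And>j. self_disjoint (f ^^ Suc S) (C j)"
     "(\<Union>n. B n) \<subseteq> (\<Union>j<k ^ Suc S + 2. C j)"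
    using finite_colouring_of_countable[OF sb sep funpow_measurable funpow_fibre, of B "Suc S"] by blast
  define \<Q>' where "\<Q>' = (\<lambda>(Q, j). Q \<inter> C j) ` (\<Q> \<times> {..<k ^ Suc S + 2})"
  have "finite \<Q>'" using Q(1) by (simp add: \<Q>'_def)
  moreover have "\<Q>' \<subseteq> sets M" using Q(2) C(1) by (auto simp: \<Q>'_def)
  moreover have "space M - periodic R \<subseteq> \<Union>\<Q>'"
  proof
    fix x assume x: "x \<in> space M - periodic R"
    then have "x \<in> B (col R x)" by (simp add: B_def)
    then obtain j where "j < k ^ Suc S + 2" "x \<in> C j" using C(3) by blast
    moreover obtain Q where "Q \<in> \<Q>" "x \<in> Q" using Q(3) x by blast
    ultimately show "x \<in> \<Union>\<Q>'" unfolding \<Q>'_def by force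
  qed
  moreover have "self_disjoint (f ^^ i) Q'" if Q': "Q' \<in> \<Q>'" and i: "i \<in> {1..Suc S}" for Q' i
  proof -
    obtain Q j where Qj: "Q \<in> \<Q>" "Q' = Q \<inter> C j" using Q' by (auto simp: \<Q>'_def)
    show ?thesis
    proof (cases "i = Suc S")
      case True then show ?thesis using C(2)[of j] Qj self_disjoint_subset by blast
    next
      case False
      then have "i \<in> {1..S}" using i by auto
      then show ?thesis using Q(4)[OF Qj(1)] Qj self_disjoint_subset by blast
    qed
  qed
  ultimately show ?case by blast
qed

section \<open>Recurrent separated sets\<close>

text \<open>Two separated sets \<open>A\<close> and \<open>Q\<close> are merged by pulling \<open>A\<close> back along \<open>f ^^ R\<close> and adding those
  \<open>R\<close>-th preimages of \<open>Q\<close> whose orbit avoids \<open>A\<close> for \<open>2 * R\<close> steps; only preimages are taken.\<close>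

lemma recurrent_separated_set:
  assumes "finite \<Q>" "\<Q> \<subseteq> sets M" "\<And>Q i. Q \<in> \<Q> \<Longrightarrow> i \<in> {1..R} \<Longrightarrow> self_disjoint (f ^^ i) Q"
  shows "\<exists>A N L. A \<in> sets M \<and> (\<forall>i\<in>{1..R}. self_disjoint (f ^^ i) A) \<and> R \<le> N \<and>
    (\<forall>x\<in>space M. (f ^^ N) x \<in> \<Union>\<Q> \<longrightarrow> (\<exists>j\<le>L. (f ^^ j) x \<in> A))"
  using assms
proof (induction \<Q>)
  case empty
  show ?case by (intro exI[of _ "{}"] exI[of _ R] exI[of _ 0]) (auto simp: self_disjoint_def)
next
  case (insert Q \<Q>)
  then obtain A N L where A: "A \<in> sets M" "\<And>i. i \<in> {1..R} \<Longrightarrow> self_disjoint (f ^^ i) A" "R \<le> N"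
    and L: "\<And>x. x \<in> space M \<Longrightarrow> (f ^^ N) x \<in> \<Union>\<Q> \<Longrightarrow> \<exists>j\<le>L. (f ^^ j) x \<in> A"
    by (metis insert_subset insertCI)
  have QS: "Q \<in> sets M" and Qi: "\<And>i. i \<in> {1..R} \<Longrightarrow> self_disjoint (f ^^ i) Q" using insert.prems by auto
  \<comment> \<open>The point \<open>x\<close> stands \<open>R\<close> steps before the point of
    \<open>Q\<close>, so the window of length \<open>2 * R\<close> shows its orbit from
    \<open>R\<close> steps before that point to \<open>R\<close> steps after it.\<close>
  define A' where "A' = {x \<in> space M. (f ^^ R) x \<in> A \<or> (f ^^ R) x \<in> Q \<and> (\<forall>j\<le>2*R. (f ^^ j) x \<notin> A)}"
  have A'S: "A' \<in> sets M" using A(1) QS unfolding A'_def by measurable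
  have "self_disjoint (f ^^ i) A'" if i: "i \<in> {1..R}" for i
    unfolding self_disjoint_def
  proof (intro ballI notI)
    fix x assume x: "x \<in> A'" and y: "(f ^^ i) x \<in> A'"
    have comm: "(f ^^ a) ((f ^^ b) x) = (f ^^ (a + b)) x" for a b by (simp add: funpow_add)
    have sh: "(f ^^ R) ((f ^^ i) x) = (f ^^ i) ((f ^^ R) x)" by (simp add: comm add.commute)
    consider "(f ^^ R) x \<in> A" "(f ^^ R) ((f ^^ i) x) \<in> A"
      | "(f ^^ R) x \<in> A" "\<forall>j\<le>2*R. (f ^^ j) ((f ^^ i) x) \<notin> A"
      | "\<forall>j\<le>2*R. (f ^^ j) x \<notin> A" "(f ^^ R) ((f ^^ i) x) \<in> A"
      | "(f ^^ R) x \<in> Q" "(f ^^ R) ((f ^^ i) x) \<in> Q"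
      using x y unfolding A'_def by blast
    then show False
    proof cases
      case 1 then show ?thesis using A(2)[OF i] unfolding sh self_disjoint_def by blast
    next
      case 2
      have "(f ^^ (R - i)) ((f ^^ i) x) = (f ^^ R) x" using i by (simp add: comm)
      with 2 show ?thesis by (metis diff_le_self le_add1 mult_2 order_trans)
    next
      case 3
      have "i + R \<le> 2 * R" using i by auto
      then show ?thesis using 3 by (simp add: comm add.commute)
    next
      case 4 then show ?thesis using Qi[OF i] unfolding sh self_disjoint_def by blast
    qed
  qed
  moreover have "\<exists>j\<le>L + N + 2 * R. (f ^^ j) x \<in> A'"
    if x: "x \<in> space M" and hit: "(f ^^ (N + R)) x \<in> \<Union>(insert Q \<Q>)" for x
  proof -
    have pull: "(f ^^ j) x \<in> A'" if "(f ^^ (j + R)) x \<in> A" for j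
      using that funpow_space[OF x] by (simp add: A'_def funpow_add add.commute)
    show ?thesis
    proof (cases "(f ^^ (N + R)) x \<in> \<Union>\<Q>")
      case True
      then have "(f ^^ N) ((f ^^ R) x) \<in> \<Union>\<Q>" by (simp add: funpow_add)
      then obtain j where j: "j \<le> L" "(f ^^ j) ((f ^^ R) x) \<in> A" using L funpow_space[OF x] by blast
      then have "(f ^^ j) x \<in> A'" using pull by (simp add: funpow_add)
      then show ?thesis using j by (intro exI[of _ j]) simp
    next
      case False
      then have "(f ^^ (R + N)) x \<in> Q" using hit by (simp add: add.commute)
      then have q: "(f ^^ R) ((f ^^ N) x) \<in> Q" by (simp add: funpow_add)
      show ?thesis
      proof (cases "\<exists>j\<le>2*R. (f ^^ j) ((f ^^ N) x) \<in> A")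
        case True
        then obtain j where j: "j \<le> 2*R" "(f ^^ (j + N)) x \<in> A" by (auto simp: funpow_add)
        \<comment> \<open>The clause \<open>R \<le> N\<close> is carried through the induction to
          make room for this move back by \<open>R\<close> steps.\<close>
        then have "(f ^^ (j + N - R)) x \<in> A'" using pull[of "j + N - R"] A(3) by simp
        then show ?thesis using j by (intro exI[of _ "j + N - R"]) simp
      next
        case False
        then have "(f ^^ N) x \<in> A'" using q funpow_space[OF x] by (auto simp: A'_def)
        then show ?thesis by (intro exI[of _ N]) simp
      qed
    qed
  qed
  moreover have "R \<le> N + R" by simp
  ultimately show ?case using A'S by blast
qed

end

section \<open>Transversals of short cycles and marker sets\<close>

context bounded_to_one_map
begin

text \<open>On each cycle of length at most \<open>R\<close> the colouring \<open>col R\<close> is injective, so its minimum picks one point.\<close>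

definition rep :: "nat \<Rightarrow> 'a set" where
  "rep R = {x \<in> periodic R. \<forall>i\<le>R. col R x \<le> col R ((f ^^ i) x)}"

lemma rep_sets: "rep R \<in> sets M"
proof -
  \<comment> \<open>The comparison of two colours is written as a countable union over the value
    \<open>n\<close> of the first.\<close>
  define D where "D i n = (col R -` {n} \<inter> space M) \<inter> ((\<lambda>x. col R ((f ^^ i) x)) -` {n..} \<inter> space M)" for i n
  have "D i n \<in> sets M" for i n
    unfolding D_def
    by (intro sets.Int measurable_sets[OF col_measurable]
        measurable_sets[OF measurable_compose[OF funpow_measurable col_measurable]]) auto
  then have "periodic R \<inter> (\<Inter>i\<in>{..R}. \<Union>n. D i n) \<in> sets M"
    by (intro sets.Int periodic_sets sets.finite_INT sets.countable_UN) auto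
  also have "periodic R \<inter> (\<Inter>i\<in>{..R}. \<Union>n. D i n) = rep R"
    by (auto simp: rep_def D_def periodic_def)
  finally show ?thesis .
qed

lemma funpow_periodic:
  assumes "x \<in> periodic R"
  shows "(f ^^ i) x \<in> periodic R"
proof -
  obtain p where p: "p \<in> {1..R}" "(f ^^ p) x = x" "x \<in> space M" using assms by (auto simp: periodic_def)
  have "(f ^^ p) ((f ^^ i) x) = (f ^^ i) ((f ^^ p) x)"
    by (metis add.commute comp_apply funpow_add)
  then show ?thesis using p funpow_space by (auto simp: periodic_def)
qed

lemma periodic_cycle:
  assumes "x \<in> periodic R"
  obtains p where "p \<in> {1..R}" "\<And>i. (f ^^ (i mod p)) x = (f ^^ i) x"
  using assms funpow_mod_eq[of _ f x] unfolding periodic_def by blast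

text \<open>Both points lie on one cycle of length at most \<open>R\<close>, so each is reached from
  the other in at most \<open>R\<close> steps. Minimality on both sides makes their colours equal,
  and \<open>col_neq\<close> rules out that they differ.\<close>

lemma rep_unique:
  assumes y: "y \<in> rep R" and iy: "(f ^^ i) y \<in> rep R"
  shows "(f ^^ i) y = y"
proof (rule ccontr)
  assume ne: "(f ^^ i) y \<noteq> y"
  have yp: "y \<in> periodic R" and yX: "y \<in> space M" using y by (auto simp: rep_def periodic_def)
  obtain p where p: "p \<in> {1..R}" "\<And>i. (f ^^ (i mod p)) y = (f ^^ i) y"
    using periodic_cycle[OF yp] by metis
  define a where "a = i mod p"
  have a: "(f ^^ a) y = (f ^^ i) y" "a < p" using p unfolding a_def by auto
  have "(f ^^ (p - a)) ((f ^^ a) y) = (f ^^ p) y"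
    using a(2) by (simp flip: comp_apply[of "f ^^ (p - a)" "f ^^ a"] funpow_add)
  also have "\<dots> = y" using p(2)[of p] by simp
  finally have ret: "(f ^^ (p - a)) ((f ^^ i) y) = y" using a by simp
  have le1: "col R y \<le> col R ((f ^^ i) y)"
    using y a p(1) unfolding rep_def by (metis (mono_tags, lifting) atLeastAtMost_iff less_imp_le_nat mem_Collect_eq order_trans)
  have "p - a \<le> R" using p(1) by auto
  then have "col R ((f ^^ i) y) \<le> col R ((f ^^ (p - a)) ((f ^^ i) y))"
    using iy unfolding rep_def by blast
  then have "col R ((f ^^ i) y) = col R y" using le1 ret by simp
  moreover have "a \<le> R" using a(2) p(1) by auto
  ultimately show False using col_neq[OF yX, of a R] a ne by simp
qed

lemma rep_reached:
  assumes x: "x \<in> periodic R"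
  shows "\<exists>j\<le>R. (f ^^ j) x \<in> rep R"
proof -
  obtain p where p: "p \<in> {1..R}" "\<And>i. (f ^^ (i mod p)) x = (f ^^ i) x"
    using periodic_cycle[OF x] by metis
  define j where "j = arg_min_on (\<lambda>j. col R ((f ^^ j) x)) {..<p}"
  have ne: "{..<p} \<noteq> {}" using p(1) by (auto simp: lessThan_empty_iff)
  have j: "j < p" using arg_min_if_finite(1)[OF _ ne] unfolding j_def by auto
  have min: "col R ((f ^^ j) x) \<le> col R ((f ^^ i) x)" if "i < p" for i
    using arg_min_least[OF _ ne, of i "\<lambda>j. col R ((f ^^ j) x)"] that unfolding j_def by auto
  have "col R ((f ^^ j) x) \<le> col R ((f ^^ i) ((f ^^ j) x))" for i
  proof -
    have "(f ^^ i) ((f ^^ j) x) = (f ^^ ((i + j) mod p)) x" using p(2) by (simp add: funpow_add)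
    then show ?thesis using min[of "(i + j) mod p"] p(1) by simp
  qed
  then have "(f ^^ j) x \<in> rep R" using funpow_periodic[OF x] by (simp add: rep_def)
  then show ?thesis using j p(1) by (intro exI[of _ j]) auto
qed

text \<open>Everything is decided at time \<open>N\<close>: if \<open>(f ^^ N) x\<close> is on a
  short cycle, \<open>rep R\<close> follows within \<open>R\<close> steps; otherwise it lies in the
  finite cover, and \<open>A\<close> is hit within \<open>L\<close> steps of
  \<open>x\<close>.\<close>

lemma marker_set_exists:
  "\<exists>A L. A \<in> sets M \<and> (\<forall>i\<in>{1..R}. self_disjoint (f ^^ i) A) \<and>
     (\<forall>x\<in>space M. \<exists>j\<le>L. (f ^^ j) x \<in> A \<union> rep R)"
proof -
  obtain \<Q> where Q: "finite \<Q>" "\<Q> \<subseteq> sets M" "space M - periodic R \<subseteq> \<Union>\<Q>"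
    "\<And>Q i. Q \<in> \<Q> \<Longrightarrow> i \<in> {1..R} \<Longrightarrow> self_disjoint (f ^^ i) Q"
    using finite_separated_cover[of R R] by auto
  obtain A N L where A: "A \<in> sets M" "\<forall>i\<in>{1..R}. self_disjoint (f ^^ i) A"
    "\<And>x. x \<in> space M \<Longrightarrow> (f ^^ N) x \<in> \<Union>\<Q> \<Longrightarrow> \<exists>j\<le>L. (f ^^ j) x \<in> A"
    using recurrent_separated_set[OF Q(1,2,4)] by metis
  have "\<exists>j\<le>L + N + R. (f ^^ j) x \<in> A \<union> rep R" if x: "x \<in> space M" for x
  proof (cases "(f ^^ N) x \<in> periodic R")
    case True
    then obtain j where "j \<le> R" "(f ^^ j) ((f ^^ N) x) \<in> rep R" using rep_reached by blast
    then show ?thesis by (intro exI[of _ "j + N"]) (auto simp: funpow_add)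
  next
    case False
    then have "(f ^^ N) x \<in> \<Union>\<Q>" using Q(3) funpow_space[OF x] by blast
    then obtain j where "j \<le> L" "(f ^^ j) x \<in> A" using A(3)[OF x] by blast
    then show ?thesis by (intro exI[of _ j]) auto
  qed
  then show ?thesis using A(1,2) by blast
qed

section \<open>First hits along a forward orbit\<close>

definition hit :: "'a set \<Rightarrow> 'a \<Rightarrow> nat" where
  "hit H x = (LEAST j. (f ^^ j) x \<in> H)"

definition first_hit :: "'a set \<Rightarrow> 'a \<Rightarrow> 'a" where
  "first_hit H x = (f ^^ hit H x) x"

lemma first_hit_measurable:
  assumes [measurable]: "H \<in> sets M"
  shows "first_hit H \<in> M \<rightarrow>\<^sub>M M"
proof -
  have "hit H \<in> M \<rightarrow>\<^sub>M count_space UNIV" unfolding hit_def by measurable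
  then show ?thesis
    unfolding first_hit_def by (rule measurable_compose_countable[OF funpow_measurable])
qed

lemma first_hit_in: "(f ^^ j) x \<in> H \<Longrightarrow> first_hit H x \<in> H"
  unfolding first_hit_def hit_def by (rule LeastI)

lemma first_hit_eq:
  assumes "m \<le> j" "(f ^^ j) x \<in> H" "\<And>i. m \<le> i \<Longrightarrow> i < j \<Longrightarrow> (f ^^ i) x \<notin> H"
  shows "first_hit H ((f ^^ m) x) = (f ^^ j) x"
proof -
  have comm: "(f ^^ i) ((f ^^ m) x) = (f ^^ (i + m)) x" for i by (simp add: funpow_add)
  have "hit H ((f ^^ m) x) = j - m"
    unfolding hit_def comm
  proof (rule Least_equality)
    show "(f ^^ (j - m + m)) x \<in> H" using assms by simp
    show "j - m \<le> i" if "(f ^^ (i + m)) x \<in> H" for i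
      using assms(3)[of "i + m"] that by linarith
  qed
  then show ?thesis using assms(1) by (simp add: first_hit_def comm)
qed

text \<open>The forward orbit of \<open>y\<close> stays on its cycle, which misses \<open>A\<close>
  and meets \<open>rep R\<close> only in \<open>y\<close>.\<close>

lemma first_hit_rep:
  assumes A: "A \<inter> periodic R = {}" and y: "y \<in> rep R"
  shows "first_hit (A \<union> rep R) ((f ^^ m) y) = y"
proof -
  let ?z = "first_hit (A \<union> rep R) ((f ^^ m) y)"
  have "(f ^^ m) y \<in> periodic R" using y funpow_periodic by (auto simp: rep_def)
  then have "?z \<in> periodic R" "?z \<in> A \<union> rep R"
    using rep_reached funpow_periodic first_hit_in unfolding first_hit_def by (blast, metis UnCI first_hit_in first_hit_def)
  then have z: "?z \<in> rep R" using A by blast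
  have "?z = (f ^^ (hit (A \<union> rep R) ((f ^^ m) y) + m)) y" by (simp add: first_hit_def funpow_add)
  then show ?thesis using rep_unique[OF y] z by metis
qed

text \<open>Let \<open>j0 < j1\<close> be the first two hitting times. A third value would need
  \<open>j1 < m \<le> R\<close>; then the two hits are fewer than \<open>R\<close> steps apart and
  cannot both lie in \<open>A\<close>. So one of them lies in \<open>rep R\<close>, and from there
  on the first hit never changes.\<close>

lemma first_hit_two_values:
  assumes A: "A \<inter> periodic R = {}" "\<And>i. i \<in> {1..R} \<Longrightarrow> self_disjoint (f ^^ i) A"
    and hits: "\<And>x. x \<in> space M \<Longrightarrow> \<exists>j. (f ^^ j) x \<in> A \<union> rep R"
    and x: "x \<in> space M"
  shows "\<exists>u v. \<forall>m\<le>R. first_hit (A \<union> rep R) ((f ^^ m) x) \<in> {u, v}"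
proof -
  let ?H = "A \<union> rep R"
  have comm: "(f ^^ i) ((f ^^ m) x) = (f ^^ (i + m)) x" for i m by (simp add: funpow_add)
  define j0 where "j0 = (LEAST j. (f ^^ j) x \<in> ?H)"
  have j0: "(f ^^ j0) x \<in> ?H" "\<And>i. i < j0 \<Longrightarrow> (f ^^ i) x \<notin> ?H"
    using hits[OF x] LeastI_ex[of "\<lambda>j. (f ^^ j) x \<in> ?H"] not_less_Least unfolding j0_def by blast+
  have before: "first_hit ?H ((f ^^ m) x) = (f ^^ j0) x" if "m \<le> j0" for m
    using first_hit_eq[OF that j0(1)] j0(2) by blast
  have rep_after: "first_hit ?H ((f ^^ m) x) = (f ^^ j) x" if "(f ^^ j) x \<in> rep R" "j \<le> m" for j m
    using first_hit_rep[OF A(1) that(1), of "m - j"] that(2) by (simp add: comm)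
  show ?thesis
  proof (cases "(f ^^ j0) x \<in> rep R")
    case True
    then have "first_hit ?H ((f ^^ m) x) = (f ^^ j0) x" for m
      using before[of m] rep_after[of j0 m] by (cases "m \<le> j0") auto
    then show ?thesis by auto
  next
    case False
    then have j0A: "(f ^^ j0) x \<in> A" using j0 by blast
    define P where "P j \<longleftrightarrow> j0 < j \<and> (f ^^ j) x \<in> ?H" for j
    obtain i where "(f ^^ (i + Suc j0)) x \<in> ?H"
      using hits[OF funpow_space[OF x, of "Suc j0"]] comm by metis
    then have "P (i + Suc j0)" by (simp add: P_def)
    define j1 where "j1 = (LEAST j. P j)"
    have "P j1" unfolding j1_def using \<open>P (i + Suc j0)\<close> by (rule LeastI)
    then have j1: "j0 < j1" "(f ^^ j1) x \<in> ?H" by (auto simp: P_def)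
    have nP: "\<not> P i" if "i < j1" for i using that not_less_Least unfolding j1_def by blast
    have mid: "first_hit ?H ((f ^^ m) x) = (f ^^ j1) x" if "j0 < m" "m \<le> j1" for m
    proof (rule first_hit_eq[OF that(2) j1(2)])
      fix i assume "m \<le> i" "i < j1"
      then show "(f ^^ i) x \<notin> ?H" using nP[of i] that(1) by (auto simp: P_def)
    qed
    have "first_hit ?H ((f ^^ m) x) \<in> {(f ^^ j0) x, (f ^^ j1) x}" if "m \<le> R" for m
    proof -
      consider "m \<le> j0" | "j0 < m" "m \<le> j1" | "j1 < m" by linarith
      then show ?thesis
      proof cases
        case 3
        have "(f ^^ j1) x \<in> rep R"
        proof (rule ccontr)
          assume "(f ^^ j1) x \<notin> rep R"
          then have "(f ^^ (j1 - j0)) ((f ^^ j0) x) \<in> A" using j1 by (simp add: comm)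
          moreover have "j1 - j0 \<in> {1..R}" using j1(1) 3 \<open>m \<le> R\<close> by auto
          ultimately show False using A(2) j0A unfolding self_disjoint_def by blast
        qed
        then show ?thesis using rep_after 3 by simp
      qed (use before mid in auto)
    qed
    then show ?thesis by blast
  qed
qed

end

section \<open>The graph metric\<close>

text \<open>Any path can be straightened into forward steps followed by backward steps: a step back
  along \<open>f\<close> cancels against a forward step right after it, because \<open>f\<close> is
  a function.\<close>

lemma graph_path_funpow_meet:
  assumes "graph_path X (fun_graph_adj X f) x p y"
  shows "\<exists>a b. (f ^^ a) x = (f ^^ b) y \<and> a + b \<le> length p - 1"
  using assms
proof (induction p arbitrary: x)
  case Nil then show ?case by (simp add: graph_path_def)
next
  case (Cons u q)
  then have ux: "u = x" by (simp add: graph_path_def)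
  show ?case
  proof (cases q)
    case Nil
    then have "y = x" using Cons.prems ux by (simp add: graph_path_def)
    then show ?thesis by (intro exI[of _ 0]) simp
  next
    case (Cons z q')
    then have path: "graph_path X (fun_graph_adj X f) z q y" and adj: "f x = z \<or> f z = x"
      using Cons.prems ux by (auto simp: graph_path_def fun_graph_adj_def)
    obtain a b where ab: "(f ^^ a) z = (f ^^ b) y" "a + b \<le> length q - 1"
      using Cons.IH[OF path] by blast
    have len: "length (u # q) - 1 = Suc (length q - 1)" using Cons by simp
    show ?thesis
    proof (cases "f x = z")
      case True
      then have "(f ^^ Suc a) x = (f ^^ b) y" using ab by (simp add: funpow_swap1)
      then show ?thesis using ab(2) len by (intro exI[of _ "Suc a"] exI[of _ b]) simp
    next
      case False
      then have fz: "f z = x" using adj by blast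
      show ?thesis
      proof (cases a)
        case 0
        then have "(f ^^ 0) x = (f ^^ Suc b) y" using ab fz by simp
        then show ?thesis using ab(2) 0 len by (intro exI[of _ 0] exI[of _ "Suc b"]) simp
      next
        case (Suc a')
        then have "(f ^^ a') x = (f ^^ b) y" using ab(1) fz by (simp add: funpow_swap1)
        then show ?thesis using ab(2) Suc len by (intro exI[of _ a'] exI[of _ b]) simp
      qed
    qed
  qed
qed

text \<open>Paths have distinct vertices, so if \<open>x\<close> already occurs, the part of
  \<open>p\<close> before \<open>x\<close> is cut off.\<close>

lemma graph_path_extend:
  assumes p: "graph_path X (fun_graph_adj X f) z p y"
    and x: "x \<in> X" and adj: "f x = z \<or> f z = x"
  shows "\<exists>q. graph_path X (fun_graph_adj X f) x q y \<and> length q \<le> Suc (length p)"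
proof (cases "x \<in> set p")
  case False
  have "hd p \<in> X" using p unfolding graph_path_def by (meson hd_in_set subsetD)
  then have "graph_path X (fun_graph_adj X f) x (x # p) y"
    using p x adj False by (auto simp: graph_path_def fun_graph_adj_def successively_Cons)
  then show ?thesis by (intro exI[of _ "x # p"]) simp
next
  case True
  then obtain us vs where s: "p = us @ x # vs" by (meson split_list)
  then have "graph_path X (fun_graph_adj X f) x (x # vs) y"
    using p by (auto simp: graph_path_def successively_append_iff)
  then show ?thesis by (intro exI[of _ "x # vs"]) (simp add: s)
qed

lemma funpow_meet_graph_path:
  assumes f: "\<And>x. x \<in> X \<Longrightarrow> f x \<in> X" and x: "x \<in> X" and y: "y \<in> X"
    and eq: "(f ^^ a) x = (f ^^ b) y"
  shows "\<exists>p. graph_path X (fun_graph_adj X f) x p y \<and> length p - 1 \<le> a + b"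
proof -
  have fX: "(f ^^ i) w \<in> X" if "w \<in> X" for i w using f that by (induction i) auto
  have down: "\<exists>p. graph_path X (fun_graph_adj X f) ((f ^^ b) y) p y \<and> length p \<le> Suc b" for b
  proof (induction b)
    case 0
    show ?case using y by (intro exI[of _ "[y]"]) (simp add: graph_path_def)
  next
    case (Suc b)
    then obtain p where p: "graph_path X (fun_graph_adj X f) ((f ^^ b) y) p y" "length p \<le> Suc b" by blast
    have "f ((f ^^ b) y) = (f ^^ Suc b) y" by simp
    then obtain q where "graph_path X (fun_graph_adj X f) ((f ^^ Suc b) y) q y" "length q \<le> Suc (length p)"
      using graph_path_extend[OF p(1) fX[OF y, of "Suc b"]] by blast
    then show ?case using p(2) by (intro exI[of _ q]) simp
  qed
  have "\<exists>p. graph_path X (fun_graph_adj X f) x p y \<and> length p \<le> Suc (a + b)"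
    using x eq
  proof (induction a arbitrary: x)
    case 0
    then show ?case using down[of b] by simp
  next
    case (Suc a)
    then have "(f ^^ a) (f x) = (f ^^ b) y" by (simp add: funpow_swap1)
    then obtain p where p: "graph_path X (fun_graph_adj X f) (f x) p y" "length p \<le> Suc (a + b)"
      using Suc.IH[OF f[OF Suc.prems(1)]] by blast
    obtain q where "graph_path X (fun_graph_adj X f) x q y" "length q \<le> Suc (length p)"
      using graph_path_extend[OF p(1) Suc.prems(1)] by blast
    then show ?case using p(2) by (intro exI[of _ q]) simp
  qed
  then obtain p where "graph_path X (fun_graph_adj X f) x p y" "length p \<le> Suc (a + b)" by blast
  then show ?thesis by (intro exI[of _ p]) simp
qed

text \<open>Without such \<open>a\<close> and \<open>b\<close> every path has at least
  \<open>\<lfloor>r\<rfloor> + 1\<close> edges, so the infimum exceeds \<open>r\<close>. This also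
  covers the case of no path at all.\<close>

lemma graph_metric_le_funpow_meet:
  assumes r: "0 < r" and le: "graph_metric X (fun_graph_adj X f) x y \<le> ennreal r"
  shows "\<exists>a b. (f ^^ a) x = (f ^^ b) y \<and> a + b \<le> nat \<lfloor>r\<rfloor>"
proof (rule ccontr)
  assume no: "\<not> ?thesis"
  have "ennreal (real (nat \<lfloor>r\<rfloor>) + 1) \<le> of_nat (length p - 1)"
    if p: "graph_path X (fun_graph_adj X f) x p y" for p
  proof -
    have "nat \<lfloor>r\<rfloor> < length p - 1"
      using graph_path_funpow_meet[OF p] no by (meson le_less_trans not_le order_trans)
    then have "real (nat \<lfloor>r\<rfloor>) + 1 \<le> real (length p - 1)" by linarith
    then show ?thesis by (metis ennreal_leI ennreal_of_nat_eq_real_of_nat)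
  qed
  then have "ennreal (real (nat \<lfloor>r\<rfloor>) + 1) \<le> graph_metric X (fun_graph_adj X f) x y"
    unfolding graph_metric_def by (intro INF_greatest) blast
  also have "\<dots> \<le> ennreal r" by fact
  finally have "real (nat \<lfloor>r\<rfloor>) + 1 \<le> r" unfolding ennreal_le_iff[OF less_imp_le[OF r]] .
  then show False by linarith
qed

lemma funpow_meet_graph_metric_le:
  assumes f: "\<And>x. x \<in> X \<Longrightarrow> f x \<in> X" and x: "x \<in> X" and y: "y \<in> X"
    and eq: "(f ^^ a) x = (f ^^ b) y"
  shows "graph_metric X (fun_graph_adj X f) x y \<le> of_nat (a + b)"
proof -
  obtain p where p: "graph_path X (fun_graph_adj X f) x p y" "length p - 1 \<le> a + b"
    using funpow_meet_graph_path[OF assms] by blast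
  have "graph_metric X (fun_graph_adj X f) x y \<le> of_nat (length p - 1)"
    unfolding graph_metric_def using p(1) by (intro INF_lower) simp
  also have "\<dots> \<le> of_nat (a + b)" using p(2) by (simp only: of_nat_mono)
  finally show ?thesis .
qed

text \<open>The witness identifies points whose \<open>n\<close>-th iterates first hit \<open>A \<union> rep R\<close> at the same
  point, where \<open>n = \<lfloor>r\<rfloor>\<close> and \<open>R = 2 * n\<close>. If \<open>f\<^sup>a x = f\<^sup>b y\<close> with \<open>a + b \<le> n\<close> then \<open>f\<^sup>n y\<close> is one
  of \<open>x, f x, \<dots>, f\<^sup>R x\<close>, along which the first hit takes at most two values.\<close>

lemma (in bounded_to_one_map) borel_asdim_witness_one:
  "borel_asdim_witness M (graph_metric (space M) (fun_graph_adj (space M) f)) 1"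
  unfolding borel_asdim_witness_def
proof (intro allI impI)
  fix r :: real assume r: "0 < r"
  let ?X = "space M" and ?\<rho> = "graph_metric (space M) (fun_graph_adj (space M) f)"
  define n where "n = nat \<lfloor>r\<rfloor>"
  define R where "R = 2 * n"
  obtain A L where AS: "A \<in> sets M" and A: "\<And>i. i \<in> {1..R} \<Longrightarrow> self_disjoint (f ^^ i) A"
    and L: "\<And>x. x \<in> ?X \<Longrightarrow> \<exists>j\<le>L. (f ^^ j) x \<in> A \<union> rep R"
    using marker_set_exists[of R] by metis
  define g where "g x = first_hit (A \<union> rep R) ((f ^^ n) x)" for x
  have Aper: "A \<inter> periodic R = {}"
  proof (rule ccontr)
    assume "A \<inter> periodic R \<noteq> {}"
    then obtain x p where "x \<in> A" "p \<in> {1..R}" "(f ^^ p) x = x" unfolding periodic_def by blast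
    then show False using A unfolding self_disjoint_def by metis
  qed
  have "A \<union> rep R \<in> sets M" using AS rep_sets by blast
  then have "first_hit (A \<union> rep R) \<circ> (f ^^ n) \<in> M \<rightarrow>\<^sub>M M"
    using measurable_comp funpow_measurable first_hit_measurable by blast
  then have gM: "g \<in> M \<rightarrow>\<^sub>M M" by (simp add: g_def[abs_def] comp_def)
  define E where "E = {(x, y). x \<in> ?X \<and> y \<in> ?X \<and> g x = g y}"
  have eqE: "equiv ?X E"
    by (rule equivI) (auto simp: E_def refl_on_def sym_def trans_def)
  have "E = {z \<in> space (M \<Otimes>\<^sub>M M). g (fst z) = g (snd z)}"
    by (auto simp: E_def space_pair_measure)
  also have "\<dots> \<in> sets (M \<Otimes>\<^sub>M M)"
    by (intro sets_Collect_eq_separating[OF sep] measurable_compose[OF measurable_fst gM]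
        measurable_compose[OF measurable_snd gM])
  finally have "borel_equiv M E" using eqE by (simp add: borel_equiv_def)
  moreover have "uniformly_bounded ?X ?\<rho> E"
    unfolding uniformly_bounded_def
  \<comment> \<open>Every point reaches its label \<open>g x\<close> in at most \<open>n + L\<close>
    steps, so two points of a class are joined through their common label.\<close>
  proof (intro exI[of _ "of_nat (2 * (n + L))"] conjI ballI)
    show "(of_nat (2 * (n + L)) :: ennreal) < \<infinity>" unfolding infinity_ennreal_def by (rule of_nat_less_top)
    fix C assume C: "C \<in> ?X // E"
    have gL: "\<exists>j\<le>n + L. g x = (f ^^ j) x" if x: "x \<in> ?X" for x
    proof -
      obtain j where j: "j \<le> L" "(f ^^ j) ((f ^^ n) x) \<in> A \<union> rep R" using L funpow_space[OF x] by blast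
      have "hit (A \<union> rep R) ((f ^^ n) x) \<le> j" unfolding hit_def using j(2) by (rule Least_le)
      moreover have "g x = (f ^^ (hit (A \<union> rep R) ((f ^^ n) x) + n)) x"
        by (simp add: g_def first_hit_def funpow_add)
      ultimately show ?thesis using j(1) by (intro exI[of _ "hit (A \<union> rep R) ((f ^^ n) x) + n"]) simp
    qed
    have "?\<rho> x y \<le> of_nat (2 * (n + L))" if xy: "x \<in> C" "y \<in> C" for x y
    proof -
      have "(x, y) \<in> E" using quotient_eq_iff[OF eqE C C xy] by simp
      then have X: "x \<in> ?X" "y \<in> ?X" and g: "g x = g y" by (auto simp: E_def)
      obtain a b where ab: "a \<le> n + L" "b \<le> n + L" "(f ^^ a) x = (f ^^ b) y"
        using gL[OF X(1)] gL[OF X(2)] g by metis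
      have "?\<rho> x y \<le> of_nat (a + b)"
        using funpow_meet_graph_metric_le[OF _ X ab(3)] measurable_space[OF f] by blast
      also have "\<dots> \<le> of_nat (2 * (n + L))" using ab by (intro of_nat_mono) simp
      finally show ?thesis .
    qed
    then show "ediam ?\<rho> C \<le> of_nat (2 * (n + L))" unfolding ediam_def by (intro SUP_least)
  qed
  moreover have "finite {C \<in> ?X // E. C \<inter> ecball ?X ?\<rho> x r \<noteq> {}} \<and>
      card {C \<in> ?X // E. C \<inter> ecball ?X ?\<rho> x r \<noteq> {}} \<le> 1 + 1" if x: "x \<in> ?X" for x
  proof -
    have hits: "\<exists>j. (f ^^ j) w \<in> A \<union> rep R" if "w \<in> ?X" for w using L[OF that] by blast
    obtain u v where uv: "\<And>m. m \<le> R \<Longrightarrow> first_hit (A \<union> rep R) ((f ^^ m) x) \<in> {u, v}"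
      using first_hit_two_values[OF Aper A hits x] by blast
    define cls where "cls w = {z \<in> ?X. g z = w}" for w
    have "C \<in> {cls u, cls v}" if C: "C \<in> ?X // E" and ne: "C \<inter> ecball ?X ?\<rho> x r \<noteq> {}" for C
    proof -
      obtain y where y: "y \<in> C" "y \<in> ?X" "?\<rho> x y \<le> ennreal r" using ne by (auto simp: ecball_def)
      obtain a b where ab: "(f ^^ a) x = (f ^^ b) y" "a + b \<le> n"
        using graph_metric_le_funpow_meet[OF r y(3)] unfolding n_def by blast
      have "(f ^^ n) y = (f ^^ (n - b)) ((f ^^ b) y)"
        using ab(2) by (simp flip: comp_apply[of "f ^^ (n - b)" "f ^^ b"] funpow_add)
      also have "\<dots> = (f ^^ (n - b + a)) x" using ab(1) by (simp add: funpow_add)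
      finally have "g y \<in> {u, v}" using uv[of "n - b + a"] ab(2) by (simp add: g_def R_def)
      moreover have "C = cls (g y)"
      proof -
        obtain w where "w \<in> ?X" "C = E `` {w}" using C by (auto elim: quotientE)
        then show ?thesis using y(1) by (auto simp: E_def cls_def)
      qed
      ultimately show ?thesis by blast
    qed
    then have sub: "{C \<in> ?X // E. C \<inter> ecball ?X ?\<rho> x r \<noteq> {}} \<subseteq> {cls u, cls v}" by blast
    have "card {C \<in> ?X // E. C \<inter> ecball ?X ?\<rho> x r \<noteq> {}} \<le> card {cls u, cls v}"
      using sub by (intro card_mono) auto
    also have "\<dots> \<le> 1 + 1" by (simp add: card_insert_if)
    finally show ?thesis using finite_subset[OF sub] by simp
  qed
  ultimately show "\<exists>E. borel_equiv M E \<and> uniformly_bounded ?X ?\<rho> E \<and>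
      (\<forall>x\<in>?X. finite {C \<in> ?X // E. C \<inter> ecball ?X ?\<rho> x r \<noteq> {}} \<and>
        card {C \<in> ?X // E. C \<inter> ecball ?X ?\<rho> x r \<noteq> {}} \<le> 1 + 1)" by blast
qed

theorem lemma8p3:
  fixes X :: "'a measure" and f :: "'a \<Rightarrow> 'a"
  assumes "standard_borel X"
    and "f \<in> X \<rightarrow>\<^sub>M X"
    and "bounded_to_one (space X) f (space X)"
  shows "borel_asdim X (graph_metric (space X) (fun_graph_adj (space X) f)) \<le> 1"
proof -
  obtain U where U: "separating X U" using standard_borel_separating[OF assms(1)] by blast
  obtain k where k: "\<forall>y\<in>space X. finite {x \<in> space X. f x = y} \<and> card {x \<in> space X. f x = y} \<le> k"
    using assms(3) unfolding bounded_to_one_def by blast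
  interpret bounded_to_one_map X U f k
    using assms(1,2) U k by unfold_locales auto
  have "borel_asdim X (graph_metric (space X) (fun_graph_adj (space X) f)) \<le> enat 1"
    unfolding borel_asdim_def using borel_asdim_witness_one by (intro INF_lower) simp
  then show ?thesis by (simp add: one_enat_def)
qed

end
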